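(* For every integer $\Delta\geq 5$ and every real $\varepsilon>0$ there exists $n(\Delta,\varepsilon)$ such that for every $n>n(\Delta,\varepsilon)$ there exists a $\Delta$-regular graph $G$ on $n$ vertices with slope-number \[\operatorname{sn}(G) \;>\; n^{1-\frac{8+\varepsilon}{\Delta+4}}.\]
   Context: Graphs are finite, simple and undirected. A (straight-line) drawing of a graph maps its vertices to distinct points in the plane and represents each edge by the closed line segment between its endpoints, such that each edge segment intersects no vertex other than its own two endpoints. The slope of an edge is the angle in $[0,\pi)$ swept anticlockwise from the $x$-axis to the line containing it. The slope-number $\operatorname{sn}(G)$ of a graph $G$ is the minimum number of distinct edge slopes over all drawings of $G$.
   Formalization: The claim is proved for those n > n(Δ,ε) for which nΔ is even; when n and Δ are both odd no Δ-regular graph on n vertices exists, so the statement as written fails there. *)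

theory Defs
  imports "HOL-Analysis.Analysis" "Graph_Theory.Pair_Digraph"
begin

text \<open>
  A finite simple undirected graph is a \<^locale>\<open>pair_graph\<close>: an edge between u and v is
  represented by the two arcs (u, v) and (v, u), so the degree of a vertex is its out-degree.
  The plane is the type of complex numbers.
\<close>

definition regular_graph :: "nat \<Rightarrow> 'a pair_pre_digraph \<Rightarrow> bool" where
  "regular_graph d G \<longleftrightarrow> pair_graph G \<and> (\<forall>v \<in> pverts G. out_degree (with_proj G) v = d)"

definition drawing :: "'a pair_pre_digraph \<Rightarrow> ('a \<Rightarrow> complex) \<Rightarrow> bool" where
  "drawing G p \<longleftrightarrow> inj_on p (pverts G) \<and>
     (\<forall>(u, v) \<in> parcs G. \<forall>w \<in> pverts G - {u, v}. p w \<notin> closed_segment (p u) (p v))"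

text \<open>
  The angle in $[0,\pi)$ by which the x-axis is turned anticlockwise to become parallel to
  the line through a and b; meaningful only for distinct points.
\<close>

definition slope :: "complex \<Rightarrow> complex \<Rightarrow> real" where
  "slope a b = (THE \<theta>. 0 \<le> \<theta> \<and> \<theta> < pi \<and> (\<exists>t::real. b - a = of_real t * cis \<theta>))"

definition edge_slopes :: "'a pair_pre_digraph \<Rightarrow> ('a \<Rightarrow> complex) \<Rightarrow> real set" where
  "edge_slopes G p = {slope (p u) (p v) | u v. (u, v) \<in> parcs G}"

definition slope_number :: "'a pair_pre_digraph \<Rightarrow> nat" where
  "slope_number G = Inf {card (edge_slopes G p) | p. drawing G p}"

lemma slope_ex1:
  assumes "a \<noteq> b"
  shows "\<exists>!\<theta>. 0 \<le> \<theta> \<and> \<theta> < pi \<and> (\<exists>t::real. b - a = of_real t * cis \<theta>)"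
proof -
  define z where "z = b - a"
  have z: "z \<noteq> 0" using assms by (simp add: z_def)
  have polar: "z = of_real (norm z) * cis (Arg z)"
    by (metis rcis_cmod_Arg rcis_def)
  have bounds: "- pi < Arg z" "Arg z \<le> pi" using Arg_bounded[of z] by auto
  have ex: "\<exists>\<theta>. 0 \<le> \<theta> \<and> \<theta> < pi \<and> (\<exists>t::real. z = of_real t * cis \<theta>)"
  proof (cases "0 \<le> Arg z \<and> Arg z < pi")
    case True
    then show ?thesis using polar by blast
  next
    case False
    define \<theta> where "\<theta> = (if Arg z < 0 then Arg z + pi else Arg z - pi)"
    have "cis (Arg z) = - cis \<theta>"
      by (auto simp: \<theta>_def complex_eq_iff)
    then have "z = of_real (- norm z) * cis \<theta>" using polar by simp
    moreover have "0 \<le> \<theta>" "\<theta> < pi" using False bounds by (auto simp: \<theta>_def)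
    ultimately show ?thesis by blast
  qed
  have uniq: "\<theta> = \<phi>"
    if "0 \<le> \<theta>" "\<theta> < pi" "z = of_real t * cis \<theta>" "0 \<le> \<phi>" "\<phi> < pi" "z = of_real s * cis \<phi>"
    for \<theta> \<phi> t s :: real
  proof -
    have t0: "t \<noteq> 0" using that z by auto
    have re: "t * cos \<theta> = s * cos \<phi>" and im: "t * sin \<theta> = s * sin \<phi>"
      using that by (auto simp: complex_eq_iff)
    have "t * sin (\<theta> - \<phi>) = (t * sin \<theta>) * cos \<phi> - (t * cos \<theta>) * sin \<phi>"
      by (simp add: sin_diff algebra_simps)
    also have "\<dots> = 0" by (simp add: re im)
    finally have "sin (\<theta> - \<phi>) = 0" using t0 by simp
    moreover have "\<bar>\<theta> - \<phi>\<bar> < pi" using that by auto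
    ultimately show "\<theta> = \<phi>" using sin_eq_0_pi[of "\<theta> - \<phi>"] by auto
  qed
  show ?thesis using ex uniq unfolding z_def by blast
qed

lemma slope_commute: "slope a b = slope b a"
proof -
  have "(\<exists>t::real. b - a = of_real t * cis \<theta>) \<longleftrightarrow> (\<exists>t::real. a - b = of_real t * cis \<theta>)" for \<theta>
    by (metis minus_diff_eq mult_minus_left of_real_minus)
  then show ?thesis by (simp add: slope_def)
qed

text \<open>Every finite graph can be drawn, so the slope number is a minimum over a nonempty set.\<close>

lemma drawing_exists:
  assumes "pair_graph G"
  shows "\<exists>p. drawing G p"
proof -
  interpret pair_graph G by fact
  obtain f :: "'a \<Rightarrow> nat" where f: "inj_on f (pverts G)"
    using pair_finite_verts finite_imp_inj_to_nat_seg by blast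
  define p where "p v = Complex (real (f v)) ((real (f v))\<^sup>2)" for v
  have on_seg: "c = a \<or> c = b"
    if seg: "Complex c (c\<^sup>2) \<in> closed_segment (Complex a (a\<^sup>2)) (Complex b (b\<^sup>2))" for a b c
  proof -
    obtain t :: real where "Complex c (c\<^sup>2) = (1 - t) *\<^sub>R Complex a (a\<^sup>2) + t *\<^sub>R Complex b (b\<^sup>2)"
      using seg by (auto simp: closed_segment_def)
    then have c: "c = (1 - t) * a + t * b" and c2: "c\<^sup>2 = (1 - t) * a\<^sup>2 + t * b\<^sup>2"
      by (auto simp: complex_eq_iff)
    have "t * (1 - t) * (a - b)\<^sup>2 = ((1 - t) * a\<^sup>2 + t * b\<^sup>2) - ((1 - t) * a + t * b)\<^sup>2"
      by (simp add: power2_eq_square algebra_simps)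
    also have "\<dots> = 0" using c c2 by simp
    finally have "t = 0 \<or> t = 1 \<or> a = b" by auto
    then show ?thesis using c by (auto simp: algebra_simps)
  qed
  have "drawing G p"
    unfolding drawing_def
  proof (intro conjI)
    show "inj_on p (pverts G)" using f by (auto simp: p_def inj_on_def)
    have "p w \<notin> closed_segment (p u) (p v)"
      if e: "(u, v) \<in> parcs G" and w: "w \<in> pverts G - {u, v}" for u v w
    proof
      assume "p w \<in> closed_segment (p u) (p v)"
      then have "f w = f u \<or> f w = f v" using on_seg unfolding p_def by fastforce
      moreover have "u \<in> pverts G" "v \<in> pverts G" using e wellformed' by auto
      ultimately show False using f w by (auto simp: inj_on_def)
    qed
    then show "\<forall>(u, v) \<in> parcs G. \<forall>w \<in> pverts G - {u, v}. p w \<notin> closed_segment (p u) (p v)"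
      by auto
  qed
  then show ?thesis by blast
qed

end

theory Submission
  imports Defs "HOL-Library.Function_Algebras" "HOL-Real_Asymp.Real_Asymp"
begin

text \<open>
  In a drawing, an edge joins two consecutive vertices on a line of one of the \<open>k\<close> slopes, so once it
  is known which vertices lie ahead of each other in the \<open>k\<close> directions, there are at most \<open>n k\<close>
  candidate edges, and at most \<open>(n k) choose (n \<Delta> / 2)\<close> graphs. That information is the sign pattern
  of \<open>O(k n\<^sup>2)\<close> quadratic polynomials in the \<open>2 n + 2 k\<close> coordinates of the drawing, and a Warren-type
  theorem bounds the number of patterns by \<open>(C k n)\<close> to the power \<open>2 n + 2 k\<close>. For
  \<open>k = n\<^bsup>1 - \<delta>\<^esup>\<close> this leaves at most \<open>n\<^bsup>(4 - 2 \<delta> + (1 - \<delta>) \<Delta> / 2 + o(1)) n\<^esup>\<close> graphs, which is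
  less than the number \<open>n\<^bsup>(\<Delta> / 2 - o(1)) n\<^esup>\<close> of lifts of the complete bipartite graph as soon as
  \<open>\<delta> > 8 / (\<Delta> + 4)\<close>.

  The Warren-type theorem needs no Bezout theorem or Morse theory: the critical points of
  \<open>g + \<epsilon> \<Sum> x\<^sub>i\<^sup>D\<close> with \<open>D > deg g\<close> are counted by reducing all polynomials modulo the
  \<open>v\<close> critical equations, which leaves a space of dimension at most \<open>(D - 1)\<^sup>v\<close>.
\<close>

section \<open>Polynomial functions in finitely many coordinates\<close>

text \<open>Collinearity is an equation, so the patterns to be counted contain zeros, while the
  critical point argument needs strict signs and no \<open>v + 1\<close> polynomials with a common
  zero. The way out is finiteness: one drawing is fixed per graph, so the polynomials are evaluated
  at finitely many points only, and constants below every nonzero absolute value met there can be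
  added freely. One shift turns each equation into two strict inequalities, a second one gives
  general position; the latter is found by a union bound over a grid, again by counting dimensions,
  in place of Sard's theorem. On the other side, lifts are used because they are counted exactly, by
  \<open>fact b ^ (d * d)\<close>, with no asymptotic enumeration of regular graphs. Since
  \<open>2 * d\<close> need not divide \<open>n\<close>, the remaining vertices carry one fixed
  circulant graph, which costs only lower order terms.\<close>

inductive poly_le :: "nat \<Rightarrow> nat \<Rightarrow> ((nat \<Rightarrow> real) \<Rightarrow> real) \<Rightarrow> bool" for v where
  const: "poly_le v m (\<lambda>u. c)"
| var: "i < v \<Longrightarrow> 1 \<le> m \<Longrightarrow> poly_le v m (\<lambda>u. u i)"
| add: "poly_le v m f \<Longrightarrow> poly_le v m g \<Longrightarrow> poly_le v m (\<lambda>u. f u + g u)"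
| mult: "poly_le v a f \<Longrightarrow> poly_le v b g \<Longrightarrow> a + b \<le> m \<Longrightarrow> poly_le v m (\<lambda>u. f u * g u)"

lemma poly_le_mono: "poly_le v m f \<Longrightarrow> m \<le> m' \<Longrightarrow> poly_le v m' f"
proof (induction arbitrary: m' rule: poly_le.induct)
  case (mult a f b g m)
  show ?case using mult.hyps mult.prems by (intro poly_le.mult[of v a f b g]) auto
qed (auto intro: poly_le.intros)

lemma poly_le_cmult: "poly_le v m f \<Longrightarrow> poly_le v m (\<lambda>u. c * f u)"
  using poly_le.mult[OF poly_le.const[of v 0 c], of m f m] by simp

lemma poly_le_diff: "poly_le v m f \<Longrightarrow> poly_le v m g \<Longrightarrow> poly_le v m (\<lambda>u. f u - g u)"
  using poly_le.add[OF _ poly_le_cmult[of v m g "-1"], of f] by simp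

lemma poly_le_sum:
  "(\<And>i. i \<in> A \<Longrightarrow> poly_le v m (f i)) \<Longrightarrow> poly_le v m (\<lambda>u. \<Sum>i\<in>A. f i u)"
  by (induction A rule: infinite_finite_induct) (auto intro: poly_le.const poly_le.add)

lemma poly_le_prod:
  "(\<And>i. i \<in> A \<Longrightarrow> poly_le v (m i) (f i)) \<Longrightarrow> poly_le v (\<Sum>i\<in>A. m i) (\<lambda>u. \<Prod>i\<in>A. f i u)"
proof (induction A rule: infinite_finite_induct)
  case (insert x F)
  then have "poly_le v (m x + (\<Sum>i\<in>F. m i)) (\<lambda>u. f x u * (\<Prod>i\<in>F. f i u))"
    by (intro poly_le.mult[OF _ _ order_refl]) auto
  then show ?case using insert.hyps by simp
qed (auto intro: poly_le.const)

lemma poly_le_power: "poly_le v m f \<Longrightarrow> poly_le v (k * m) (\<lambda>u. f u ^ k)"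
  using poly_le_prod[of "{..<k}" v "\<lambda>_. m" "\<lambda>_. f"] by simp

lemma poly_le_continuous: "poly_le v m f \<Longrightarrow> continuous_on A f"
proof (induction rule: poly_le.induct)
  case (var i m)
  show ?case by (rule continuous_on_subset[OF continuous_on_product_coordinates subset_UNIV])
qed (simp_all add: continuous_on_add continuous_on_mult)

lemma poly_le_partial_deriv:
  assumes "poly_le v m f"
  shows "\<exists>f'. poly_le v (m - 1) f' \<and>
    (\<forall>u. ((\<lambda>t. f (u(i := t))) has_real_derivative f' u) (at (u i)))"
  using assms
proof (induction rule: poly_le.induct)
  case (const m c)
  show ?case by (rule exI[of _ "\<lambda>u. 0"]) (auto intro: poly_le.const)
next
  case (var j m)
  show ?case
    by (rule exI[of _ "\<lambda>u. if i = j then 1 else 0"]) (auto intro: poly_le.const)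
next
  case (add m f g)
  then obtain f' g' where f': "poly_le v (m - 1) f'"
      "\<And>u. ((\<lambda>t. f (u(i := t))) has_real_derivative f' u) (at (u i))"
    and g': "poly_le v (m - 1) g'"
      "\<And>u. ((\<lambda>t. g (u(i := t))) has_real_derivative g' u) (at (u i))"
    by blast
  show ?case
    using poly_le.add[OF f'(1) g'(1)] f'(2) g'(2)
    by (intro exI[of _ "\<lambda>u. f' u + g' u"]) (simp add: DERIV_add del: fun_upd_apply)
next
  case (mult a f b g m)
  then obtain f' g' where f': "poly_le v (a - 1) f'"
      "\<And>u. ((\<lambda>t. f (u(i := t))) has_real_derivative f' u) (at (u i))"
    and g': "poly_le v (b - 1) g'"
      "\<And>u. ((\<lambda>t. g (u(i := t))) has_real_derivative g' u) (at (u i))"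
    by blast
  have deriv: "((\<lambda>t. f (u(i := t)) * g (u(i := t))) has_real_derivative
      f' u * g u + g' u * f u) (at (u i))" for u
    using DERIV_mult[OF f'(2)[of u] g'(2)[of u]] by (simp only: fun_upd_triv)
  show ?case
  proof (cases "a = 0 \<or> b = 0")
    case False
    have "poly_le v (m - 1) (\<lambda>u. f' u * g u + g' u * f u)"
      using mult.hyps f' g' False
      by (intro poly_le.add poly_le.mult[where a = "a - 1" and b = b] poly_le.mult[where a = "b - 1" and b = a]) auto
    then show ?thesis
      using deriv
      by (intro exI[of _ "\<lambda>u. f' u * g u + g' u * f u"]) (simp del: fun_upd_apply)
  next
    case True
    \<comment> \<open>Subtraction truncates at 0, so for \<open>a = 0\<close> the product of
      \<open>f'\<close> and \<open>g\<close> is only known to have degree \<open>b\<close>, which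
      may exceed \<open>m - 1\<close>; the derivative of a constant must be seen to vanish.\<close>
    have const_deriv: "h' = (\<lambda>u. 0)" if h: "poly_le v 0 h" "\<And>u. ((\<lambda>t. h (u(i := t))) has_real_derivative h' u) (at (u i))" for h h'
    proof -
      have "poly_le v k h \<Longrightarrow> k = 0 \<Longrightarrow> \<exists>c. h = (\<lambda>u. c)" for k h
        by (induction rule: poly_le.induct) (auto simp: fun_eq_iff)
      then obtain c where c: "h = (\<lambda>u. c)" using h(1) by blast
      show ?thesis using h(2) DERIV_unique[OF _ DERIV_const] unfolding c by blast
    qed
    have "poly_le v (m - 1) (\<lambda>u. f' u * g u + g' u * f u)"
    proof (intro poly_le.add)
      show "poly_le v (m - 1) (\<lambda>u. f' u * g u)"
      proof (cases "a = 0")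
        case True
        then have "f' = (\<lambda>u. 0)" using const_deriv mult.hyps f' by blast
        then show ?thesis by (auto intro: poly_le.const)
      next
        case False
        then show ?thesis using mult.hyps f' by (intro poly_le.mult[where a = "a - 1" and b = b]) auto
      qed
      show "poly_le v (m - 1) (\<lambda>u. g' u * f u)"
      proof (cases "b = 0")
        case True
        then have "g' = (\<lambda>u. 0)" using const_deriv mult.hyps g' by blast
        then show ?thesis by (auto intro: poly_le.const)
      next
        case False
        then show ?thesis using mult.hyps g' by (intro poly_le.mult[where a = "b - 1" and b = a]) auto
      qed
    qed
    then show ?thesis
      using deriv
      by (intro exI[of _ "\<lambda>u. f' u * g u + g' u * f u"]) (simp del: fun_upd_apply)
  qed
qed

section \<open>Counting points by the dimension of a space of functions\<close>

interpretation fun_space: vector_space "\<lambda>c f u. c * f u :: real"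
  by standard (auto simp: fun_eq_iff algebra_simps)

lemma fun_space_subspaceI:
  fixes V :: "('u \<Rightarrow> real) set"
  assumes "(\<lambda>u. 0) \<in> V" "\<And>f g. f \<in> V \<Longrightarrow> g \<in> V \<Longrightarrow> (\<lambda>u. f u + g u) \<in> V"
    "\<And>c f. f \<in> V \<Longrightarrow> (\<lambda>u. c * f u) \<in> V"
  shows "fun_space.subspace V"
  using assms by (auto simp: fun_space.subspace_def zero_fun_def plus_fun_def)

lemma fun_space_span_add:
  "f \<in> fun_space.span B \<Longrightarrow> g \<in> fun_space.span B \<Longrightarrow> (\<lambda>u. f u + g u) \<in> fun_space.span B"
  using fun_space.span_add[of f B g] by (simp add: plus_fun_def)

lemma fun_space_span_mult:
  assumes f: "f \<in> fun_space.span A" and g: "g \<in> fun_space.span B"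
    and AB: "\<And>a b. a \<in> A \<Longrightarrow> b \<in> B \<Longrightarrow> (\<lambda>u. a u * b u) \<in> C"
  shows "(\<lambda>u. f u * g u) \<in> fun_space.span C"
proof -
  have zero: "(\<lambda>u. 0) \<in> fun_space.span C" for C :: "('a \<Rightarrow> real) set"
    using fun_space.span_zero[of C] by (simp add: zero_fun_def)
  have 1: "(\<lambda>u. a u * g u) \<in> fun_space.span C" if "a \<in> A" for a
  proof -
    have "fun_space.subspace {g. (\<lambda>u. a u * g u) \<in> fun_space.span C}"
      using zero fun_space_span_add[of _ C] fun_space.span_scale[of _ C]
      by (intro fun_space_subspaceI) (auto simp: distrib_left mult.left_commute)
    moreover have "B \<subseteq> {g. (\<lambda>u. a u * g u) \<in> fun_space.span C}"
      using AB that by (auto intro: fun_space.span_base)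
    ultimately have "fun_space.span B \<subseteq> {g. (\<lambda>u. a u * g u) \<in> fun_space.span C}"
      by (intro fun_space.span_minimal)
    then show ?thesis using g by blast
  qed
  have "fun_space.subspace {f. (\<lambda>u. f u * g u) \<in> fun_space.span C}"
    using zero fun_space_span_add[of _ C] fun_space.span_scale[of _ C]
    by (intro fun_space_subspaceI) (auto simp: distrib_right mult.assoc)
  moreover have "A \<subseteq> {f. (\<lambda>u. f u * g u) \<in> fun_space.span C}" using 1 by blast
  ultimately have "fun_space.span A \<subseteq> {f. (\<lambda>u. f u * g u) \<in> fun_space.span C}"
    by (intro fun_space.span_minimal)
  then show ?thesis using f by blast
qed

text \<open>Evaluating a vanishing combination of the separating functions at \<open>x\<close>
  isolates the coefficient belonging to \<open>x\<close>, so they are independent in a space of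
  dimension at most \<open>card B\<close>.\<close>

lemma card_le_dim_of_separating_functions:
  fixes X :: "'u set" and B :: "('u \<Rightarrow> real) set"
  assumes X: "finite X" and B: "finite B"
    and sep: "\<And>x. x \<in> X \<Longrightarrow> \<exists>g \<in> fun_space.span B. g x \<noteq> 0 \<and> (\<forall>y \<in> X - {x}. g y = 0)"
  shows "card X \<le> card B"
proof -
  obtain g where g: "\<And>x. x \<in> X \<Longrightarrow> g x \<in> fun_space.span B"
    "\<And>x. x \<in> X \<Longrightarrow> g x x \<noteq> 0" "\<And>x y. x \<in> X \<Longrightarrow> y \<in> X \<Longrightarrow> y \<noteq> x \<Longrightarrow> g x y = 0"
    using bchoice[of X "\<lambda>x g. g \<in> fun_space.span B \<and> g x \<noteq> 0 \<and> (\<forall>y \<in> X - {x}. g y = 0)"] sep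
    by (metis Diff_iff singletonD)
  have inj: "inj_on g X"
    by (rule inj_onI) (metis g(2,3))
  have "\<not> fun_space.dependent (g ` X)"
  proof
    assume "fun_space.dependent (g ` X)"
    then obtain c f where c: "f \<in> g ` X" "c f \<noteq> 0" "(\<Sum>f\<in>g ` X. (\<lambda>u. c f * f u)) = 0"
      using fun_space.dependent_finite[of "g ` X"] X by auto
    then obtain x where x: "x \<in> X" "f = g x" by blast
    have "0 = (\<Sum>f\<in>g ` X. (\<lambda>u. c f * f u)) x" using c(3) by simp
    also have "\<dots> = (\<Sum>f\<in>g ` X. c f * f x)"
    proof -
      have "(\<Sum>f\<in>F. (\<lambda>u. c f * f u)) x = (\<Sum>f\<in>F. c f * f x)" for F
        by (induction F rule: infinite_finite_induct) auto
      then show ?thesis .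
    qed
    also have "\<dots> = (\<Sum>y\<in>X. c (g y) * g y x)" using inj by (simp add: sum.reindex)
    also have "\<dots> = (\<Sum>y\<in>X. if y = x then c (g x) * g x x else 0)"
      using g(3) x by (intro sum.cong) auto
    also have "\<dots> = c (g x) * g x x" using X x by simp
    finally show False using c x g(2) by simp
  qed
  moreover have "g ` X \<subseteq> fun_space.span B" using g(1) by blast
  ultimately have "card (g ` X) \<le> card B"
    using fun_space.independent_span_bound[OF B] by blast
  then show ?thesis using inj by (simp add: card_image)
qed

section \<open>Monomials with exponents in a box, and reduction modulo power relations\<close>

definition monomial :: "nat \<Rightarrow> (nat \<Rightarrow> nat) \<Rightarrow> (nat \<Rightarrow> real) \<Rightarrow> real" where
  "monomial v a u = (\<Prod>i<v. u i ^ a i)"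

definition box_monomials :: "nat \<Rightarrow> nat \<Rightarrow> ((nat \<Rightarrow> real) \<Rightarrow> real) set" where
  "box_monomials v e = monomial v ` ({..<v} \<rightarrow>\<^sub>E {..<e})"

lemma monomial_cong: "(\<And>i. i < v \<Longrightarrow> a i = b i) \<Longrightarrow> monomial v a = monomial v b"
  by (auto simp: monomial_def fun_eq_iff intro!: prod.cong)

lemma monomial_mult: "monomial v a u * monomial v b u = monomial v (\<lambda>i. a i + b i) u"
  by (simp add: monomial_def prod.distrib power_add)

lemma box_monomialsI: "(\<And>i. i < v \<Longrightarrow> a i < e) \<Longrightarrow> monomial v a \<in> box_monomials v e"
  unfolding box_monomials_def
  by (rule image_eqI[of _ _ "restrict a {..<v}"]) (auto intro!: monomial_cong)

lemma finite_box_monomials: "finite (box_monomials v e)"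
  unfolding box_monomials_def by (intro finite_imageI finite_PiE) auto

lemma card_box_monomials_le: "card (box_monomials v e) \<le> e ^ v"
  unfolding box_monomials_def
  by (rule order_trans[OF card_image_le]) (auto intro!: finite_PiE simp: card_PiE)

lemma poly_le_monomial: "(\<Sum>i<v. a i) \<le> m \<Longrightarrow> poly_le v m (monomial v a)"
proof (rule poly_le_mono)
  have "poly_le v (a i) (\<lambda>u. u i ^ a i)" if "i < v" for i
    using poly_le_power[OF poly_le.var[OF that order_refl], of "a i"] by simp
  then show "poly_le v (\<Sum>i<v. a i) (monomial v a)"
    unfolding monomial_def[abs_def] by (intro poly_le_prod) auto
qed

text \<open>The bridge from \<open>poly_le\<close>, a degree bound along some construction of the
  function, to linear algebra; formal polynomials never appear.\<close>

lemma poly_le_in_span_monomials: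
  assumes "poly_le v m f"
  shows "f \<in> fun_space.span {monomial v a | a. (\<Sum>i<v. a i) \<le> m}"
  using assms
proof (induction rule: poly_le.induct)
  case (const m c)
  have "monomial v (\<lambda>i. 0) \<in> {monomial v a | a. (\<Sum>i<v. a i) \<le> m}" by force
  then have "(\<lambda>u. c * monomial v (\<lambda>i. 0) u) \<in> fun_space.span {monomial v a | a. (\<Sum>i<v. a i) \<le> m}"
    by (intro fun_space.span_scale fun_space.span_base)
  moreover have "(\<lambda>u. c * monomial v (\<lambda>i. 0) u) = (\<lambda>u. c)" by (simp add: monomial_def)
  ultimately show ?case by simp
next
  case (var i m)
  have eq: "monomial v (\<lambda>j. if j = i then 1 else 0) = (\<lambda>u. u i)"
    using var by (simp add: monomial_def fun_eq_iff if_distrib[of "\<lambda>a. _ ^ a"] prod.If_cases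
        Int_absorb1 cong: if_cong)
  have mem: "monomial v (\<lambda>j. if j = i then 1 else 0) \<in> {monomial v a | a. (\<Sum>i<v. a i) \<le> m}"
    using var by force
  show ?case using fun_space.span_base[OF mem] by (simp only: eq)
next
  case (add m f g)
  then show ?case by (intro fun_space_span_add)
next
  case (mult a f b g m)
  show ?case
  proof (rule fun_space_span_mult[OF mult.IH])
    fix p q
    assume "p \<in> {monomial v x | x. (\<Sum>i<v. x i) \<le> a}" "q \<in> {monomial v x | x. (\<Sum>i<v. x i) \<le> b}"
    then obtain x y where "p = monomial v x" "(\<Sum>i<v. x i) \<le> a" "q = monomial v y" "(\<Sum>i<v. y i) \<le> b"
      by auto
    then show "(\<lambda>u. p u * q u) \<in> {monomial v a | a. (\<Sum>i<v. a i) \<le> m}"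
      using mult.hyps by (auto simp: monomial_mult sum.distrib intro!: exI[of _ "\<lambda>i. x i + y i"])
  qed
qed

lemma poly_le_in_span_box: "poly_le v m f \<Longrightarrow> f \<in> fun_space.span (box_monomials v (m + 1))"
proof -
  have "{monomial v a | a. (\<Sum>i<v. a i) \<le> m} \<subseteq> box_monomials v (m + 1)"
  proof safe
    fix a :: "nat \<Rightarrow> nat" assume "(\<Sum>i<v. a i) \<le> m"
    then have "a i < m + 1" if "i < v" for i
      using member_le_sum[of i "{..<v}" a] that by simp
    then show "monomial v a \<in> box_monomials v (m + 1)" by (rule box_monomialsI)
  qed
  then show "poly_le v m f \<Longrightarrow> f \<in> fun_space.span (box_monomials v (m + 1))"
    using poly_le_in_span_monomials fun_space.span_mono by blast
qed

text \<open>Rewriting the powers \<open>x\<^sub>i\<^sup>e\<close> by polynomials of smaller degree terminates, so modulo the relations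
  every polynomial is a combination of monomials with all exponents below \<open>e\<close>.\<close>

lemma poly_le_reduce_to_box:
  assumes q: "\<And>i. i < v \<Longrightarrow> poly_le v (e - 1) (q i)"
    and rel: "\<And>i x. i < v \<Longrightarrow> x \<in> X \<Longrightarrow> x i ^ e = q i x"
    and e: "1 \<le> e" and f: "poly_le v m f"
  shows "\<exists>g \<in> fun_space.span (box_monomials v e). \<forall>x\<in>X. g x = f x"
  using f
proof (induction m arbitrary: f rule: less_induct)
  case (less m)
  define V where "V = {f. \<exists>g \<in> fun_space.span (box_monomials v e). \<forall>x\<in>X. g x = f x}"
  have "fun_space.subspace V"
  proof (rule fun_space_subspaceI)
    show "(\<lambda>u. 0) \<in> V"
      unfolding V_def using fun_space.span_zero by (auto intro!: bexI[of _ 0])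
    show "(\<lambda>u. f u + g u) \<in> V" if fg: "f \<in> V" "g \<in> V" for f g
    proof -
      obtain f' g' where "f' \<in> fun_space.span (box_monomials v e)" "\<forall>x\<in>X. f' x = f x"
        "g' \<in> fun_space.span (box_monomials v e)" "\<forall>x\<in>X. g' x = g x"
        using fg unfolding V_def by blast
      then show ?thesis unfolding V_def
        using fun_space_span_add[of f' _ g'] by (auto intro!: bexI[of _ "\<lambda>u. f' u + g' u"])
    qed
    show "(\<lambda>u. c * f u) \<in> V" if f: "f \<in> V" for c f
    proof -
      obtain f' where "f' \<in> fun_space.span (box_monomials v e)" "\<forall>x\<in>X. f' x = f x"
        using f unfolding V_def by blast
      then show ?thesis unfolding V_def
        using fun_space.span_scale[of f' _ c] by (auto intro!: bexI[of _ "\<lambda>u. c * f' u"])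
    qed
  qed
  moreover have "monomial v a \<in> V" if a: "(\<Sum>i<v. a i) \<le> m" for a
  proof (cases "\<forall>i<v. a i < e")
    case True
    then have "monomial v a \<in> fun_space.span (box_monomials v e)"
      by (intro fun_space.span_base box_monomialsI) auto
    then show ?thesis unfolding V_def by blast
  next
    case False
    then obtain i where i: "i < v" "e \<le> a i" by force
    define b where "b = a(i := a i - e)"
    have sum: "(\<Sum>j<v. a j) = a i + (\<Sum>j\<in>{..<v}-{i}. a j)" "(\<Sum>j<v. b j) = a i - e + (\<Sum>j\<in>{..<v}-{i}. a j)"
      using i by (auto simp: b_def sum.remove[of "{..<v}" i])
    have prod: "monomial v a u = u i ^ e * monomial v b u" for u
      using i by (simp add: monomial_def b_def prod.remove[of "{..<v}" i] flip: power_add mult.assoc)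
    \<comment> \<open>Trading \<open>u i ^ e\<close> for \<open>q i\<close>, of degree at most
      \<open>e - 1\<close>, lowers the total degree, so the induction on \<open>m\<close>
      applies.\<close>
    have "poly_le v (m - 1) (\<lambda>u. q i u * monomial v b u)"
      using i sum a e by (intro poly_le.mult[OF q poly_le_monomial[OF order_refl]]) auto
    moreover have "m - 1 < m" using i sum a e by auto
    ultimately have "(\<lambda>u. q i u * monomial v b u) \<in> V" using less.IH unfolding V_def by blast
    then show ?thesis unfolding V_def using prod rel i by auto
  qed
  ultimately have "fun_space.span {monomial v a | a. (\<Sum>i<v. a i) \<le> m} \<subseteq> V"
    by (intro fun_space.span_minimal) auto
  then have "f \<in> V" using poly_le_in_span_monomials[OF less.prems] by blast
  then show ?case by (simp add: V_def)
qed

text \<open>Points of \<open>v\<close>-dimensional space are encoded as sequences with zero tail, so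
  that the dimension varies without a change of type and the first \<open>v\<close> coordinates
  determine the point.\<close>

definition coord_space :: "nat \<Rightarrow> (nat \<Rightarrow> real) set" where
  "coord_space v = {u. \<forall>i\<ge>v. u i = 0}"

text \<open>A product of linear functions separates a point from all others. Its degree grows with
  \<open>card X\<close>, but on \<open>X\<close> it agrees with a combination of the at most
  \<open>e ^ v\<close> box monomials, so the degree does not enter the bound.\<close>

lemma card_zeros_le:
  assumes q: "\<And>i. i < v \<Longrightarrow> poly_le v (e - 1) (q i)"
    and rel: "\<And>i x. i < v \<Longrightarrow> x \<in> X \<Longrightarrow> x i ^ e = q i x"
    and e: "1 \<le> e" and X: "finite X" "X \<subseteq> coord_space v"
  shows "card X \<le> e ^ v"
proof -
  have "card X \<le> card (box_monomials v e)"
  proof (rule card_le_dim_of_separating_functions[OF X(1) finite_box_monomials])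
    fix x assume x: "x \<in> X"
    have "\<exists>i<v. x i \<noteq> y i" if y: "y \<in> X - {x}" for y
    proof (rule ccontr)
      assume neg: "\<not> (\<exists>i<v. x i \<noteq> y i)"
      have "x \<in> coord_space v" "y \<in> coord_space v" using x y X(2) by auto
      then have "x i = y i" for i
        using neg by (cases "i < v") (auto simp: coord_space_def)
      then show False using y by auto
    qed
    then have "\<forall>y\<in>X-{x}. \<exists>i. i < v \<and> x i \<noteq> y i" by blast
    from bchoice[OF this] obtain i where i: "\<And>y. y \<in> X - {x} \<Longrightarrow> i y < v \<and> x (i y) \<noteq> y (i y)"
      by blast
    define f where "f = (\<lambda>u. \<Prod>y\<in>X-{x}. u (i y) - y (i y))"
    have "poly_le v (\<Sum>y\<in>X-{x}. 1) f"
      unfolding f_def using i by (intro poly_le_prod poly_le_diff poly_le.var poly_le.const) auto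
    then obtain g where g: "g \<in> fun_space.span (box_monomials v e)" "\<forall>x\<in>X. g x = f x"
      using poly_le_reduce_to_box[OF q rel e] by blast
    moreover have "f x \<noteq> 0" "\<forall>y\<in>X-{x}. f y = 0"
      using X(1) i by (auto simp: f_def prod_zero_iff)
    ultimately show "\<exists>g\<in>fun_space.span (box_monomials v e). g x \<noteq> 0 \<and> (\<forall>y\<in>X-{x}. g y = 0)"
      using x by (intro bexI[of _ g]) auto
  qed
  then show ?thesis using card_box_monomials_le order_trans by blast
qed

section \<open>The number of sign patterns\<close>

lemma compact_power_sum_sublevel:
  assumes "even D" "0 < D"
  shows "compact {w \<in> coord_space v. (\<Sum>i<v. w i ^ D) \<le> R}"
proof -
  \<comment> \<open>The tail coordinates are confined to 0, so the box is compact in the product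
    topology. The \<open>+ 1\<close> makes coordinates outside the box exceed 1 in absolute value,
    hence be bounded by their \<open>D\<close>-th power.\<close>
  define B where "B = (\<lambda>i. if i < v then {- (\<bar>R\<bar> + 1)..\<bar>R\<bar> + 1} else {0::real})"
  have "compactin (product_topology (\<lambda>i::nat. euclidean) UNIV) (PiE UNIV B)"
    unfolding compactin_PiE by (auto simp: B_def)
  then have "compact (PiE UNIV B)"
    by (simp add: euclidean_product_topology)
  moreover have "closed {w. (\<Sum>i<v. w i ^ D) \<le> R}"
    by (intro closed_Collect_le continuous_on_sum continuous_on_power continuous_on_const
        continuous_on_product_coordinates)
  ultimately have "compact (PiE UNIV B \<inter> {w. (\<Sum>i<v. w i ^ D) \<le> R})"
    by (rule compact_Int_closed)
  moreover have "PiE UNIV B \<inter> {w. (\<Sum>i<v. w i ^ D) \<le> R} = {w \<in> coord_space v. (\<Sum>i<v. w i ^ D) \<le> R}"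
  proof -
    have "\<bar>w i\<bar> \<le> \<bar>R\<bar> + 1" if "(\<Sum>i<v. w i ^ D) \<le> R" "i < v" for w :: "nat \<Rightarrow> real" and i
    proof (rule ccontr)
      assume "\<not> ?thesis"
      then have big: "\<bar>w i\<bar> > \<bar>R\<bar> + 1" by simp
      have "\<bar>w i\<bar> ^ 1 \<le> \<bar>w i\<bar> ^ D" using big assms by (intro power_increasing) auto
      also have "\<dots> = w i ^ D" using assms(1) by (simp add: power_even_abs)
      also have "\<dots> \<le> (\<Sum>i<v. w i ^ D)"
        using that(2) assms(1) by (intro member_le_sum) (auto simp: zero_le_even_power)
      finally show False using big that(1) by simp
    qed
    then show ?thesis
      unfolding B_def coord_space_def by (fastforce simp: PiE_def Pi_def abs_le_iff)
  qed
  ultimately show ?thesis by simp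
qed

text \<open>Since \<open>g\<close> vanishes somewhere in the open chamber but not on its boundary, a small coercive
  perturbation of \<open>g\<close> attains its minimum over the closed chamber in the interior.\<close>

lemma interior_critical_point:
  fixes \<phi> :: "'j \<Rightarrow> (nat \<Rightarrow> real) \<Rightarrow> real"
  assumes g: "poly_le v m g" "\<And>u. 0 \<le> g u"
    and J: "finite J" and \<phi>: "\<And>j. j \<in> J \<Longrightarrow> poly_le v d (\<phi> j)"
    and a: "a \<in> coord_space v" "\<And>j. j \<in> J \<Longrightarrow> \<phi> j a > 0" "g a = 0"
    and bd: "\<And>w j. w \<in> coord_space v \<Longrightarrow> (\<And>i. i \<in> J \<Longrightarrow> \<phi> i w \<ge> 0) \<Longrightarrow> j \<in> J \<Longrightarrow> \<phi> j w = 0 \<Longrightarrow> g w \<noteq> 0"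
    and D: "even D" "0 < D"
  shows "\<exists>\<epsilon>0>0. \<forall>\<epsilon>. 0 < \<epsilon> \<and> \<epsilon> < \<epsilon>0 \<longrightarrow> (\<exists>w \<in> coord_space v. (\<forall>j\<in>J. \<phi> j w > 0) \<and>
    (\<forall>i<v. \<forall>l. ((\<lambda>t. g (w(i := t))) has_real_derivative l) (at (w i)) \<longrightarrow>
      l + \<epsilon> * (real D * w i ^ (D - 1)) = 0))"
proof -
  define N where "N = (\<lambda>w :: nat \<Rightarrow> real. \<Sum>i<v. w i ^ D)"
  \<comment> \<open>Cutting at the level of \<open>a\<close> makes the closed chamber compact and
    keeps \<open>a\<close> in it.\<close>
  define R where "R = N a"
  define C where "C = {w \<in> coord_space v. N w \<le> R} \<inter> (\<Inter>j\<in>J. {w. 0 \<le> \<phi> j w})"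
  define B where "B = C \<inter> (\<Union>j\<in>J. {w. \<phi> j w = 0})"
  have N_nonneg: "0 \<le> N w" for w unfolding N_def using D by (intro sum_nonneg) (simp add: zero_le_even_power)
  have contN: "continuous_on A N" for A
    unfolding N_def
    by (intro continuous_on_sum continuous_on_power continuous_on_subset[OF continuous_on_product_coordinates]) auto
  have compC: "compact C"
    unfolding C_def
  proof (rule compact_Int_closed)
    show "compact {w \<in> coord_space v. N w \<le> R}" unfolding N_def by (rule compact_power_sum_sublevel[OF D])
    show "closed (\<Inter>j\<in>J. {w. 0 \<le> \<phi> j w})"
      by (intro closed_INT ballI closed_Collect_le continuous_on_const poly_le_continuous[OF \<phi>])
  qed
  have compB: "compact B"
    unfolding B_def
    by (intro compact_Int_closed compC closed_UN J ballI closed_Collect_eq continuous_on_const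
        poly_le_continuous[OF \<phi>])
  have "\<exists>c>0. \<forall>w\<in>B. c \<le> g w"
  proof (cases "B = {}")
    case False
    obtain b where b: "b \<in> B" "\<forall>w\<in>B. g b \<le> g w"
      using continuous_attains_inf[OF compB False poly_le_continuous[OF g(1)]] by blast
    have "g b \<noteq> 0" using b(1) bd[of b] unfolding B_def C_def by auto
    then show ?thesis using b(2) g(2)[of b] by (intro exI[of _ "g b"]) auto
  qed (auto intro: exI[of _ 1])
  then obtain c where c: "c > 0" "\<And>w. w \<in> B \<Longrightarrow> c \<le> g w" by blast
  have aC: "a \<in> C" using a by (auto simp: C_def R_def less_imp_le)
  have R0: "0 \<le> R" using N_nonneg by (simp add: R_def)
  show ?thesis
  \<comment> \<open>On \<open>B\<close> the perturbed function is at least \<open>c\<close>, at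
    \<open>a\<close> it equals \<open>\<epsilon> * R\<close>; this choice yields
    \<open>\<epsilon> * R < c\<close>, so the minimum avoids \<open>B\<close>. The
    \<open>+ 1\<close> covers \<open>R = 0\<close>.\<close>
  proof (intro exI[of _ "c / (R + 1)"] conjI allI impI)
    show "0 < c / (R + 1)" using c R0 by simp
    fix \<epsilon> :: real assume "0 < \<epsilon> \<and> \<epsilon> < c / (R + 1)"
    then have \<epsilon>: "0 < \<epsilon>" "\<epsilon> * (R + 1) < c" using R0 by (auto simp: field_simps)
    define h where "h = (\<lambda>w. g w + \<epsilon> * N w)"
    have "continuous_on C h"
      unfolding h_def by (intro continuous_on_add continuous_on_mult continuous_on_const contN poly_le_continuous[OF g(1)])
    then obtain w where w: "w \<in> C" "\<And>x. x \<in> C \<Longrightarrow> h w \<le> h x"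
      using continuous_attains_inf[OF compC] aC by blast
    have ha: "h a = \<epsilon> * R" by (simp add: h_def a R_def)
    have "w \<notin> B"
    proof
      assume "w \<in> B"
      then have "c \<le> h w" using c(2) N_nonneg[of w] \<epsilon> by (simp add: h_def add_increasing2)
      also have "h w \<le> \<epsilon> * R" using w(2)[OF aC] ha by simp
      finally show False using \<epsilon> by (simp add: algebra_simps)
    qed
    then have pos: "\<phi> j w > 0" if "j \<in> J" for j
      using w(1) that unfolding B_def C_def by (auto simp: less_le)
    have wc: "w \<in> coord_space v" using w(1) by (simp add: C_def)
    have crit: "l + \<epsilon> * (real D * w i ^ (D - 1)) = 0"
      if i: "i < v" and l: "((\<lambda>t. g (w(i := t))) has_real_derivative l) (at (w i))" for i l
    proof -
      have "\<forall>\<^sub>F t in nhds (w i). 0 < \<phi> j (w(i := t))" if j: "j \<in> J" for j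
      proof -
        obtain f' where "((\<lambda>t. \<phi> j (w(i := t))) has_real_derivative f' w) (at (w i))"
          using poly_le_partial_deriv[OF \<phi>[OF j], of i] by blast
        then have "isCont (\<lambda>t. \<phi> j (w(i := t))) (w i)" by (rule DERIV_isCont)
        then have "((\<lambda>t. \<phi> j (w(i := t))) \<longlongrightarrow> \<phi> j (w(i := w i))) (nhds (w i))"
          unfolding isCont_def
          using tendsto_at_iff_tendsto_nhds[of "\<lambda>t. \<phi> j (w(i := t))" "w i"] by blast
        then show ?thesis using pos[OF j] by (intro order_tendstoD(1)[where y = "\<phi> j w"]) (simp_all only: fun_upd_triv)
      qed
      then have "\<forall>\<^sub>F t in nhds (w i). \<forall>j\<in>J. 0 < \<phi> j (w(i := t))"
        using J by (simp add: eventually_ball_finite_distrib)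
      then obtain r where r: "r > 0" "\<And>t j. dist t (w i) < r \<Longrightarrow> j \<in> J \<Longrightarrow> 0 < \<phi> j (w(i := t))"
        unfolding eventually_nhds_metric by blast
      \<comment> \<open>The minimizer may lie on the artificial cut \<open>N w = R\<close>. Beyond
        the cut, however, \<open>h\<close> exceeds \<open>\<epsilon> * R = h a \<ge> h w\<close>, so
        \<open>w\<close> is still a local minimum in each coordinate.\<close>
      have min: "h (w(i := w i)) \<le> h (w(i := t))" if t: "\<bar>w i - t\<bar> < r" for t
      proof -
        have mem: "w(i := t) \<in> coord_space v" using wc i by (auto simp: coord_space_def)
        have posd: "0 < \<phi> j (w(i := t))" if "j \<in> J" for j
          using r(2)[OF _ that] t by (simp add: dist_real_def abs_minus_commute)
        show ?thesis
        proof (cases "N (w(i := t)) \<le> R")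
          case True
          then have "w(i := t) \<in> C" using mem posd unfolding C_def by (auto simp: less_imp_le simp del: fun_upd_apply)
          then show ?thesis using w(2) by simp
        next
          case False
          then have "\<epsilon> * R \<le> h (w(i := t))"
            using \<epsilon>(1) g(2)[of "w(i := t)"] unfolding h_def
            by (smt (verit) mult_left_mono)
          then show ?thesis using w(2)[OF aC] ha by simp
        qed
      qed
      have "N (w(i := t)) = t ^ D + (\<Sum>j\<in>{..<v}-{i}. w j ^ D)" for t
        unfolding N_def using i by (simp add: sum.remove[of "{..<v}" i])
      then have "((\<lambda>t. N (w(i := t))) has_real_derivative real D * w i ^ (D - 1)) (at (w i))"
        by (auto intro!: derivative_eq_intros)
      then have "((\<lambda>t. h (w(i := t))) has_real_derivative l + \<epsilon> * (real D * w i ^ (D - 1))) (at (w i))"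
        unfolding h_def by (intro DERIV_add l DERIV_cmult)
      then show ?thesis using DERIV_local_min[OF _ r(1)] min by blast
    qed
    show "\<exists>w\<in>coord_space v. (\<forall>j\<in>J. 0 < \<phi> j w) \<and>
      (\<forall>i<v. \<forall>l. ((\<lambda>t. g (w(i := t))) has_real_derivative l) (at (w i)) \<longrightarrow>
        l + \<epsilon> * (real D * w i ^ (D - 1)) = 0)"
      using wc pos crit by blast
  qed
qed

text \<open>Counts the keys by which sign patterns are sorted below: a set of polynomials made to
  vanish, and the signs thereby lost on it.\<close>

lemma card_Sigma_subsets_Pow_le:
  assumes "finite I"
  shows "card (SIGMA S:{S. S \<subseteq> I \<and> card S \<le> v}. Pow S) \<le> (\<Sum>j\<le>v. (card I choose j) * 2 ^ j)"
proof -
  have "(SIGMA S:{S. S \<subseteq> I \<and> card S \<le> v}. Pow S) = (\<Union>j\<le>v. SIGMA S:{S. S \<subseteq> I \<and> card S = j}. Pow S)"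
    by auto
  also have "card \<dots> \<le> (\<Sum>j\<le>v. card (SIGMA S:{S. S \<subseteq> I \<and> card S = j}. Pow S))"
    by (rule card_UN_le) simp
  also have "\<dots> = (\<Sum>j\<le>v. (card I choose j) * 2 ^ j)"
  proof (rule sum.cong[OF refl])
    fix j
    have "card (SIGMA S:{S. S \<subseteq> I \<and> card S = j}. Pow S) = (\<Sum>S | S \<subseteq> I \<and> card S = j. card (Pow S))"
      using assms by (intro card_SigmaI) (auto intro: finite_subset)
    also have "\<dots> = (\<Sum>S | S \<subseteq> I \<and> card S = j. 2 ^ j)"
      using finite_subset[OF _ assms] by (intro sum.cong) (auto simp: card_Pow)
    also have "\<dots> = (card I choose j) * 2 ^ j" using n_subsets[OF assms, of j] by simp
    finally show "card (SIGMA S:{S. S \<subseteq> I \<and> card S = j}. Pow S) = (card I choose j) * 2 ^ j" .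
  qed
  finally show ?thesis .
qed

lemma card_le_fibers_bound:
  assumes K: "finite K" "card K \<le> k" "key ` A \<subseteq> K" and b: "\<And>x. x \<in> K \<Longrightarrow> card {a \<in> A. key a = x} \<le> b"
  shows "card A \<le> k * b"
proof -
  have "A = (\<Union>x\<in>K. {a \<in> A. key a = x})" using K by auto
  then have "card A \<le> (\<Sum>x\<in>K. card {a \<in> A. key a = x})" using card_UN_le[OF K(1)] by metis
  also have "\<dots> \<le> card K * b" using sum_bounded_above[of K "\<lambda>x. card {a \<in> A. key a = x}" b] b by simp
  finally show ?thesis using K(2) by (meson mult_le_mono1 order_trans)
qed

text \<open>Assign to a sign pattern a maximal set \<open>S\<close> of polynomials that can be made to vanish while all
  others keep their sign. By maximality the chamber has no boundary on the variety \<open>{f\<^sub>i = 0, i \<in> S}\<close>,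
  so patterns that share \<open>S\<close> are separated by critical points of a perturbation of \<open>\<Sum>\<^sub>i\<^sub>\<in>\<^sub>S f\<^sub>i\<^sup>2\<close>.\<close>

lemma card_sign_patterns_general_position:
  fixes f :: "'i \<Rightarrow> (nat \<Rightarrow> real) \<Rightarrow> real"
  assumes I: "finite I" and f: "\<And>i. i \<in> I \<Longrightarrow> poly_le v d (f i)"
    and gp: "\<And>S u. S \<subseteq> I \<Longrightarrow> card S = Suc v \<Longrightarrow> u \<in> coord_space v \<Longrightarrow> \<exists>i\<in>S. f i u \<noteq> 0"
    and U: "U \<subseteq> coord_space v" "\<And>u i. u \<in> U \<Longrightarrow> i \<in> I \<Longrightarrow> f i u \<noteq> 0"
  shows "card ((\<lambda>u. {i \<in> I. f i u > 0}) ` U) \<le> (\<Sum>j\<le>v. (card I choose j) * 2 ^ j) * (2 * d + 1) ^ v"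
proof -
  define Pat where "Pat = (\<lambda>u. {i \<in> I. f i u > 0}) ` U"
  define sg where "sg = (\<lambda>\<sigma> (i::'i). if i \<in> \<sigma> then 1 else -1 :: real)"
  define A where "A = (\<lambda>\<sigma> S. {w \<in> coord_space v. (\<forall>i\<in>S. f i w = 0) \<and> (\<forall>j\<in>I-S. sg \<sigma> j * f j w > 0)})"
  have PatI: "\<sigma> \<subseteq> I" if "\<sigma> \<in> Pat" for \<sigma> using that by (auto simp: Pat_def)
  then have "Pat \<subseteq> Pow I" by blast
  then have finPat: "finite Pat" using I finite_subset by blast
  define mx where "mx = (\<lambda>\<sigma> S. S \<subseteq> I \<and> A \<sigma> S \<noteq> {} \<and>
    (\<forall>T. T \<subseteq> I \<and> A \<sigma> T \<noteq> {} \<and> S \<subseteq> T \<longrightarrow> S = T))"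
  have "\<exists>S. mx \<sigma> S" if pat: "\<sigma> \<in> Pat" for \<sigma>
  proof -
    obtain u where u: "u \<in> U" "\<sigma> = {i \<in> I. f i u > 0}" using pat by (auto simp: Pat_def)
    have "sg \<sigma> j * f j u > 0" if "j \<in> I" for j
      using u that U(2)[OF u(1) that] by (auto simp: sg_def)
    then have "u \<in> A \<sigma> {}" using u U(1) by (auto simp: A_def)
    define Q where "Q = {S. S \<subseteq> I \<and> A \<sigma> S \<noteq> {}}"
    have "Q \<noteq> {}" using \<open>u \<in> A \<sigma> {}\<close> by (auto simp: Q_def)
    moreover have "finite Q" using I by (simp add: Q_def)
    ultimately obtain S where S: "S \<in> Q" "\<forall>T\<in>Q. S \<subseteq> T \<longrightarrow> S = T"
      using finite_has_maximal[of Q] by blast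
    show ?thesis
      unfolding mx_def
    proof (intro exI conjI allI impI)
      show "S \<subseteq> I" "A \<sigma> S \<noteq> {}" using S(1) by (simp_all add: Q_def)
      fix T assume "T \<subseteq> I \<and> A \<sigma> T \<noteq> {} \<and> S \<subseteq> T"
      then show "S = T" using S(2) by (simp add: Q_def)
    qed
  qed
  then obtain M where "\<And>\<sigma>. \<sigma> \<in> Pat \<Longrightarrow> mx \<sigma> (M \<sigma>)" by metis
  then have M: "\<And>\<sigma>. \<sigma> \<in> Pat \<Longrightarrow> M \<sigma> \<subseteq> I" "\<And>\<sigma>. \<sigma> \<in> Pat \<Longrightarrow> A \<sigma> (M \<sigma>) \<noteq> {}"
    and max: "\<And>\<sigma> T. \<sigma> \<in> Pat \<Longrightarrow> T \<subseteq> I \<Longrightarrow> A \<sigma> T \<noteq> {} \<Longrightarrow> M \<sigma> \<subseteq> T \<Longrightarrow> M \<sigma> = T"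
    unfolding mx_def by simp_all
  \<comment> \<open>All polynomials of \<open>M \<sigma>\<close> have a common zero, which general
    position permits for at most \<open>v\<close> of them.\<close>
  have cardM: "card (M \<sigma>) \<le> v" if pat: "\<sigma> \<in> Pat" for \<sigma>
  proof (rule ccontr)
    assume "\<not> ?thesis"
    then obtain T where T: "T \<subseteq> M \<sigma>" "card T = Suc v"
      using obtain_subset_with_card_n[of "Suc v" "M \<sigma>"] by (metis not_less_eq_eq)
    obtain w where "w \<in> A \<sigma> (M \<sigma>)" using M(2)[OF pat] by blast
    then have "w \<in> coord_space v" "\<forall>i\<in>T. f i w = 0" using T by (auto simp: A_def)
    then show False using gp[of T w] T M(1)[OF pat] by blast
  qed
  have "card Pat \<le> (\<Sum>j\<le>v. (card I choose j) * 2 ^ j) * (2 * d + 1) ^ v"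
  \<comment> \<open>\<open>A \<sigma> S\<close> does not see the signs on \<open>S\<close>; the
    second component of the key restores them.\<close>
  proof (rule card_le_fibers_bound[OF _ card_Sigma_subsets_Pow_le[OF I], where key = "\<lambda>\<sigma>. (M \<sigma>, \<sigma> \<inter> M \<sigma>)"])
    show "finite (SIGMA S:{S. S \<subseteq> I \<and> card S \<le> v}. Pow S)"
      using I by (intro finite_SigmaI) (auto intro: finite_subset[OF _ I])
    show "(\<lambda>\<sigma>. (M \<sigma>, \<sigma> \<inter> M \<sigma>)) ` Pat \<subseteq> (SIGMA S:{S. S \<subseteq> I \<and> card S \<le> v}. Pow S)"
      using M(1) cardM by auto
    fix K assume "K \<in> (SIGMA S:{S. S \<subseteq> I \<and> card S \<le> v}. Pow S)"
    then obtain S \<tau> where K: "K = (S, \<tau>)" "S \<subseteq> I" by auto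
    define F where "F = {\<sigma> \<in> Pat. (M \<sigma>, \<sigma> \<inter> M \<sigma>) = K}"
    have F: "\<sigma> \<in> Pat" "M \<sigma> = S" "\<sigma> \<inter> S = \<tau>" if "\<sigma> \<in> F" for \<sigma> using that K by (auto simp: F_def)
    have finF: "finite F" using finPat by (simp add: F_def)
    have finS: "finite S" using K(2) I finite_subset by blast
    define g where "g = (\<lambda>u. \<Sum>i\<in>S. (f i u)\<^sup>2)"
    have g: "poly_le v (2 * d) g"
      unfolding g_def using K(2) by (intro poly_le_sum poly_le_power f) auto
    have g0: "g w = 0 \<longleftrightarrow> (\<forall>i\<in>S. f i w = 0)" for w
      unfolding g_def using finS by (simp add: sum_nonneg_eq_0_iff)
    \<comment> \<open>The exponent \<open>2 * d + 2\<close> is even, for coercivity, and exceeds the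
      degree \<open>2 * d\<close> of \<open>g\<close>, so that each critical equation can be solved
      for the top power of one coordinate.\<close>
    define crit where "crit = (\<lambda>\<epsilon> \<sigma> w. w \<in> coord_space v \<and> (\<forall>j\<in>I-S. sg \<sigma> j * f j w > 0) \<and>
      (\<forall>i<v. \<forall>l. ((\<lambda>t. g (w(i := t))) has_real_derivative l) (at (w i)) \<longrightarrow>
        l + \<epsilon> * (real (2 * d + 2) * w i ^ (2 * d + 2 - 1)) = 0))"
    have "\<exists>\<epsilon>0>0. \<forall>\<epsilon>. 0 < \<epsilon> \<and> \<epsilon> < \<epsilon>0 \<longrightarrow> (\<exists>w. crit \<epsilon> \<sigma> w)" if \<sigma>: "\<sigma> \<in> F" for \<sigma>
    proof -
      obtain a where a: "a \<in> A \<sigma> S" using M(2) F[OF \<sigma>] by auto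
      have "\<exists>\<epsilon>0>0. \<forall>\<epsilon>. 0 < \<epsilon> \<and> \<epsilon> < \<epsilon>0 \<longrightarrow> (\<exists>w \<in> coord_space v. (\<forall>j\<in>I-S. sg \<sigma> j * f j w > 0) \<and>
        (\<forall>i<v. \<forall>l. ((\<lambda>t. g (w(i := t))) has_real_derivative l) (at (w i)) \<longrightarrow>
          l + \<epsilon> * (real (2 * d + 2) * w i ^ (2 * d + 2 - 1)) = 0))"
      proof (rule interior_critical_point[OF g])
        show "0 \<le> g u" for u by (auto simp: g_def intro: sum_nonneg)
        show "finite (I - S)" using I by simp
        show "poly_le v d (\<lambda>w. sg \<sigma> j * f j w)" if "j \<in> I - S" for j
          using that f by (intro poly_le_cmult) auto
        show "a \<in> coord_space v" "g a = 0" using a by (auto simp: A_def g0)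
        show "sg \<sigma> j * f j a > 0" if "j \<in> I - S" for j using a that by (auto simp: A_def)
        show "g w \<noteq> 0" if w: "w \<in> coord_space v" "\<And>i. i \<in> I - S \<Longrightarrow> sg \<sigma> i * f i w \<ge> 0"
          "j \<in> I - S" "sg \<sigma> j * f j w = 0" for w j
        proof
          assume gw: "g w = 0"
          \<comment> \<open>A zero of \<open>g\<close> on the boundary kills all of \<open>S\<close>
            and also \<open>j\<close>, so \<open>T\<close> would contradict the maximality of
            \<open>S\<close>.\<close>
          define T where "T = {i \<in> I. f i w = 0}"
          have "S \<subseteq> T" using gw K(2) by (auto simp: T_def g0)
          moreover have "w \<in> A \<sigma> T"
          proof -
            have "sg \<sigma> i * f i w > 0" if "i \<in> I - T" for i
            proof -
              have "i \<in> I - S" "f i w \<noteq> 0" using that \<open>S \<subseteq> T\<close> by (auto simp: T_def)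
              then show ?thesis using w(2)[of i] by (auto simp: less_le sg_def split: if_splits)
            qed
            then show ?thesis using w(1) by (auto simp: A_def T_def)
          qed
          ultimately have "S = T" using max[OF F(1)[OF \<sigma>], of T] F(2)[OF \<sigma>] by (auto simp: T_def)
          moreover have "j \<in> T" using w(3,4) by (auto simp: T_def sg_def split: if_splits)
          ultimately show False using w(3) by simp
        qed
      qed auto
      then show ?thesis by (simp only: crit_def Bex_def)
    qed
    then have "\<forall>\<sigma>\<in>F. \<exists>\<epsilon>0. \<epsilon>0 > 0 \<and> (\<forall>\<epsilon>. 0 < \<epsilon> \<and> \<epsilon> < \<epsilon>0 \<longrightarrow> (\<exists>w. crit \<epsilon> \<sigma> w))" by blast
    from bchoice[OF this] obtain \<epsilon>0 where \<epsilon>0: "\<And>\<sigma>. \<sigma> \<in> F \<Longrightarrow> \<epsilon>0 \<sigma> > (0::real)"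
      "\<And>\<sigma> \<epsilon>. \<sigma> \<in> F \<Longrightarrow> 0 < \<epsilon> \<Longrightarrow> \<epsilon> < \<epsilon>0 \<sigma> \<Longrightarrow> \<exists>w. crit \<epsilon> \<sigma> w"
      by blast
    \<comment> \<open>One \<open>\<epsilon>\<close> serves the whole fiber, so that all critical
      points solve the same system of equations and can be counted together.\<close>
    define \<epsilon> where "\<epsilon> = Min (insert 1 (\<epsilon>0 ` F)) / 2"
    have "0 < Min (insert 1 (\<epsilon>0 ` F))" using finF \<epsilon>0(1) by (simp add: Min_gr_iff)
    then have \<epsilon>: "0 < \<epsilon>" by (simp add: \<epsilon>_def)
    have "\<epsilon> < \<epsilon>0 \<sigma>" if "\<sigma> \<in> F" for \<sigma>
    proof -
      have "Min (insert 1 (\<epsilon>0 ` F)) \<le> \<epsilon>0 \<sigma>" using finF that by (intro Min_le) auto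
      then show ?thesis using \<epsilon>0(1)[OF that] by (simp add: \<epsilon>_def)
    qed
    then have "\<forall>\<sigma>\<in>F. \<exists>w. crit \<epsilon> \<sigma> w" using \<epsilon>0(2) \<epsilon> by blast
    from bchoice[OF this] obtain W where W: "\<And>\<sigma>. \<sigma> \<in> F \<Longrightarrow> crit \<epsilon> \<sigma> (W \<sigma>)" by blast
    \<comment> \<open>Distinct patterns of the fiber differ on \<open>I - S\<close>, and the signs
      there can be read off at the critical point.\<close>
    have injW: "inj_on W F"
    proof (rule inj_onI)
      fix \<sigma> \<sigma>' assume s: "\<sigma> \<in> F" "\<sigma>' \<in> F" "W \<sigma> = W \<sigma>'"
      have "j \<in> \<sigma> \<longleftrightarrow> j \<in> \<sigma>'" if "j \<in> I - S" for j
      proof -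
        have "sg \<sigma> j * f j (W \<sigma>) > 0" "sg \<sigma>' j * f j (W \<sigma>) > 0"
          using W[OF s(1)] W[OF s(2)] that s(3) by (auto simp: crit_def)
        then show ?thesis by (auto simp: sg_def split: if_splits)
      qed
      moreover have "\<sigma> \<subseteq> I" "\<sigma>' \<subseteq> I" "\<sigma> \<inter> S = \<sigma>' \<inter> S" using s F PatI by auto
      ultimately show "\<sigma> = \<sigma>'" by blast
    qed
    have "\<forall>i. \<exists>g'. poly_le v (2 * d - 1) g' \<and>
      (\<forall>u. ((\<lambda>t. g (u(i := t))) has_real_derivative g' u) (at (u i)))"
      using poly_le_partial_deriv[OF g] by blast
    then obtain g' where g': "\<And>i. poly_le v (2 * d - 1) (g' i)"
      "\<And>i u. ((\<lambda>t. g (u(i := t))) has_real_derivative g' i u) (at (u i))"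
      by metis
    have "card (W ` F) \<le> (2 * d + 1) ^ v"
    proof (rule card_zeros_le[where q = "\<lambda>i u. (- 1 / (\<epsilon> * real (2 * d + 2))) * g' i u"])
      show "poly_le v (2 * d + 1 - 1) (\<lambda>u. (- 1 / (\<epsilon> * real (2 * d + 2))) * g' i u)" for i
        by (intro poly_le_cmult poly_le_mono[OF g'(1)]) auto
      show "x i ^ (2 * d + 1) = (- 1 / (\<epsilon> * real (2 * d + 2))) * g' i x" if i: "i < v" "x \<in> W ` F" for i x
      proof -
        obtain \<sigma> where "x = W \<sigma>" "\<sigma> \<in> F" using i by blast
        then have "g' i x + \<epsilon> * (real (2 * d + 2) * x i ^ (2 * d + 2 - 1)) = 0"
          using W[of \<sigma>] i(1) g'(2)[where u = x and i = i] unfolding crit_def by blast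
        then have "(\<epsilon> * real (2 * d + 2)) * x i ^ (2 * d + 1) = - g' i x" by (simp add: algebra_simps)
        moreover have "\<epsilon> * real (2 * d + 2) > 0" using \<epsilon> by simp
        ultimately show ?thesis by (simp add: field_simps)
      qed
      show "W ` F \<subseteq> coord_space v" using W by (auto simp: crit_def)
    qed (use finF in auto)
    then show "card {\<sigma> \<in> Pat. (M \<sigma>, \<sigma> \<inter> M \<sigma>) = K} \<le> (2 * d + 1) ^ v"
      using injW by (simp add: card_image flip: F_def)
  qed
  then show ?thesis by (simp add: Pat_def)
qed

text \<open>An interpolation argument: on the solution set every function of the grid vector \<open>y\<close> is a
  polynomial in the \<open>f i\<close>, hence the number of attained grid vectors is bounded by a dimension.\<close>

lemma card_attained_grid_le:
  fixes f :: "'i \<Rightarrow> (nat \<Rightarrow> real) \<Rightarrow> real" and M :: nat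
  assumes S: "finite S" and f: "\<And>i. i \<in> S \<Longrightarrow> poly_le v d (f i)" and c: "c \<noteq> 0"
  shows "card {y \<in> S \<rightarrow>\<^sub>E {..<M}. \<exists>u\<in>coord_space v. \<forall>i\<in>S. f i u + c * real (y i) = 0}
    \<le> (card S * M * d + 1) ^ v"
proof -
  define Y where "Y = {y \<in> S \<rightarrow>\<^sub>E {..<M}. \<exists>u\<in>coord_space v. \<forall>i\<in>S. f i u + c * real (y i) = 0}"
  have finY: "finite Y" unfolding Y_def using S by (simp add: finite_PiE)
  have "\<exists>u. \<forall>i\<in>S. f i u + c * real (y i) = 0" if "y \<in> Y" for y
    using that by (auto simp: Y_def)
  then obtain u where u: "\<And>y i. y \<in> Y \<Longrightarrow> i \<in> S \<Longrightarrow> f i (u y) + c * real (y i) = 0" by metis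
  have diff: "\<exists>i\<in>S. y i \<noteq> y' i" if "y \<in> Y" "y' \<in> Y" "y \<noteq> y'" for y y'
    using that by (auto simp: Y_def dest: PiE_ext)
  have inj: "inj_on u Y"
  proof (rule inj_onI, rule ccontr)
    fix y y' assume y: "y \<in> Y" "y' \<in> Y" "u y = u y'" "y \<noteq> y'"
    then obtain i where i: "i \<in> S" "y i \<noteq> y' i" using diff by blast
    have "c * real (y i) = c * real (y' i)" using u[OF y(1) i(1)] u[OF y(2) i(1)] y(3) by (simp add: add_eq_0_iff)
    then show False using c i(2) by simp
  qed
  have "card (u ` Y) \<le> card (box_monomials v (card S * M * d + 1))"
  proof (rule card_le_dim_of_separating_functions)
    fix x assume "x \<in> u ` Y"
    then obtain y where y: "y \<in> Y" "x = u y" by blast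
    \<comment> \<open>Since \<open>f i\<close> takes the value \<open>- c * real (y i)\<close> at
      \<open>u y\<close>, this is, up to scaling, the Lagrange polynomial of the grid point
      \<open>y\<close>, pulled back along \<open>f\<close>.\<close>
    define g where "g = (\<lambda>w. \<Prod>i\<in>S. \<Prod>l\<in>{..<M}-{y i}. f i w + c * real l)"
    have "poly_le v (\<Sum>i\<in>S. \<Sum>l\<in>{..<M}-{y i}. d) g"
      unfolding g_def by (intro poly_le_prod poly_le.add f poly_le.const)
    moreover have "(\<Sum>i\<in>S. \<Sum>l\<in>{..<M}-{y i}. d) \<le> card S * M * d"
    proof -
      have "(\<Sum>i\<in>S. \<Sum>l\<in>{..<M}-{y i}. d) \<le> (\<Sum>i\<in>S. M * d)"
      proof (rule sum_mono)
        fix i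
        have "card ({..<M} - {y i}) \<le> M" by (metis card_Diff1_le card_lessThan)
        then show "(\<Sum>l\<in>{..<M}-{y i}. d) \<le> M * d" by simp
      qed
      then show ?thesis by simp
    qed
    ultimately have "g \<in> fun_space.span (box_monomials v (card S * M * d + 1))"
      using poly_le_in_span_box poly_le_mono by blast
    moreover have "g x \<noteq> 0"
    proof -
      have "f i x + c * real l \<noteq> 0" if "i \<in> S" "l \<in> {..<M} - {y i}" for i l
      proof -
        have "f i x + c * real l = c * (real l - real (y i))"
          using u[OF y(1) that(1)] y(2) by (simp add: algebra_simps)
        then show ?thesis using that(2) c by simp
      qed
      then show ?thesis using S by (simp add: g_def)
    qed
    moreover have "g z = 0" if z: "z \<in> u ` Y - {x}" for z
    proof -
      obtain y' where y': "y' \<in> Y" "z = u y'" "y' \<noteq> y" using z y by auto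
      obtain i where i: "i \<in> S" "y' i \<noteq> y i" using diff y' y by blast
      have "y' i \<in> {..<M} - {y i}" using i y'(1) by (auto simp: Y_def)
      moreover have "f i z + c * real (y' i) = 0" using u y' i by simp
      ultimately have "(\<Prod>l\<in>{..<M}-{y i}. f i z + c * real l) = 0" by (intro prod_zero) auto
      then show ?thesis unfolding g_def using S i(1) by (intro prod_zero) auto
    qed
    ultimately show "\<exists>g\<in>fun_space.span (box_monomials v (card S * M * d + 1)).
        g x \<noteq> 0 \<and> (\<forall>z\<in>u ` Y - {x}. g z = 0)" by blast
  qed (use finY finite_box_monomials in auto)
  then have "card Y \<le> card (box_monomials v (card S * M * d + 1))"
    using inj by (simp add: card_image)
  also have "\<dots> \<le> (card S * M * d + 1) ^ v" by (rule card_box_monomials_le)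
  finally show ?thesis by (simp add: Y_def)
qed

lemma card_restrict_in_le:
  assumes I: "finite I" and S: "S \<subseteq> I" and Y: "finite Y"
  shows "card {y \<in> I \<rightarrow>\<^sub>E {..<M::nat}. restrict y S \<in> Y} \<le> card Y * M ^ card (I - S)"
proof -
  have "inj_on (\<lambda>y. (restrict y S, restrict y (I - S))) {y \<in> I \<rightarrow>\<^sub>E {..<M}. restrict y S \<in> Y}"
  proof (rule inj_onI)
    fix y z
    assume yz: "y \<in> {y \<in> I \<rightarrow>\<^sub>E {..<M}. restrict y S \<in> Y}" "z \<in> {y \<in> I \<rightarrow>\<^sub>E {..<M}. restrict y S \<in> Y}"
      and eq: "(restrict y S, restrict y (I - S)) = (restrict z S, restrict z (I - S))"
    show "y = z"
    proof (rule PiE_ext[of _ I "\<lambda>_. {..<M}"])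
      fix i assume "i \<in> I"
      then show "y i = z i" using eq by (metis DiffI prod.inject restrict_apply')
    qed (use yz in auto)
  qed
  moreover have "(\<lambda>y. (restrict y S, restrict y (I - S))) ` {y \<in> I \<rightarrow>\<^sub>E {..<M}. restrict y S \<in> Y}
      \<subseteq> Y \<times> ((I - S) \<rightarrow>\<^sub>E {..<M})"
    by auto
  moreover have "finite (Y \<times> ((I - S) \<rightarrow>\<^sub>E {..<M}))" using I Y by (auto intro: finite_PiE)
  ultimately have "card {y \<in> I \<rightarrow>\<^sub>E {..<M}. restrict y S \<in> Y} \<le> card (Y \<times> ((I - S) \<rightarrow>\<^sub>E {..<M}))"
    by (rule card_inj_on_le)
  also have "\<dots> = card Y * M ^ card (I - S)" using I by (simp add: card_cartesian_product card_PiE)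
  finally show ?thesis .
qed

text \<open>For a fixed \<open>S\<close> of size \<open>v + 1\<close> only O(\<open>M ^ v\<close>)
  of the \<open>M ^ (v + 1)\<close> grid shifts on \<open>S\<close> produce a common zero, so a fine
  enough grid contains a shift that is bad for no \<open>S\<close>.\<close>

lemma exists_generic_shift:
  fixes f :: "'i \<Rightarrow> (nat \<Rightarrow> real) \<Rightarrow> real"
  assumes I: "finite I" and f: "\<And>i. i \<in> I \<Longrightarrow> poly_le v d (f i)" and \<gamma>: "\<gamma> > 0"
  shows "\<exists>\<eta>. (\<forall>i\<in>I. 0 \<le> \<eta> i \<and> \<eta> i \<le> \<gamma>) \<and>
    (\<forall>S u. S \<subseteq> I \<and> card S = Suc v \<and> u \<in> coord_space v \<longrightarrow> (\<exists>i\<in>S. f i u + \<eta> i \<noteq> 0))"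
proof -
  define L where "L = (Suc v * d + 1) ^ v"
  \<comment> \<open>\<open>2 ^ card I\<close> bounds the number of sets \<open>S\<close>, and
    \<open>L * M ^ (card I - 1)\<close> the number of shifts that are bad for one of them.\<close>
  define M where "M = 2 ^ card I * L + 1"
  define c where "c = \<gamma> / real M"
  have M: "M > 0" by (simp add: M_def)
  have c: "c > 0" using \<gamma> M by (simp add: c_def)
  define \<S> where "\<S> = {S. S \<subseteq> I \<and> card S = Suc v}"
  define Y where "Y = (\<lambda>S. {y \<in> S \<rightarrow>\<^sub>E {..<M}. \<exists>u\<in>coord_space v. \<forall>i\<in>S. f i u + c * real (y i) = 0})"
  define Bad where "Bad = (\<lambda>S. {y \<in> I \<rightarrow>\<^sub>E {..<M}. restrict y S \<in> Y S})"
  have fin\<S>: "finite \<S>" using I by (simp add: \<S>_def)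
  have card\<S>: "card \<S> \<le> 2 ^ card I"
    using card_mono[of "Pow I" \<S>] I by (auto simp: \<S>_def card_Pow)
  have bad: "card (Bad S) \<le> L * M ^ (card I - 1)" if S: "S \<in> \<S>" for S
  proof -
    have S': "S \<subseteq> I" "card S = Suc v" "finite S" using S I by (auto simp: \<S>_def intro: finite_subset)
    have "card (Bad S) \<le> card (Y S) * M ^ card (I - S)"
      unfolding Bad_def using I S' by (intro card_restrict_in_le) (auto simp: Y_def finite_PiE)
    also have "card (Y S) \<le> (Suc v * M * d + 1) ^ v"
      using card_attained_grid_le[of S v d f c M] S' f c by (auto simp: Y_def)
    also have "(Suc v * M * d + 1) ^ v \<le> (M * (Suc v * d + 1)) ^ v"
      by (intro power_mono) (auto simp: M_def algebra_simps)
    also have "(M * (Suc v * d + 1)) ^ v * M ^ card (I - S) = L * M ^ (v + card (I - S))"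
      unfolding L_def power_mult_distrib power_add by (simp only: mult_ac)
    also have "v + card (I - S) = card I - 1"
      using S' card_Diff_subset[of S I] card_mono[OF I S'(1)] by simp
    finally show ?thesis by simp
  qed
  have "card (\<Union>S\<in>\<S>. Bad S) < card (I \<rightarrow>\<^sub>E {..<M})"
  proof (cases "\<S> = {}")
    case True
    then show ?thesis using I by (simp add: card_PiE M_def)
  next
    case False
    then obtain S where "S \<in> \<S>" by blast
    then have I0: "card I > 0" using card_mono[OF I, of S] by (auto simp: \<S>_def)
    have "card (\<Union>S\<in>\<S>. Bad S) \<le> (\<Sum>S\<in>\<S>. card (Bad S))" by (rule card_UN_le[OF fin\<S>])
    also have "\<dots> \<le> card \<S> * (L * M ^ (card I - 1))"
      using sum_bounded_above[of \<S> "\<lambda>S. card (Bad S)"] bad by simp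
    also have "\<dots> \<le> 2 ^ card I * (L * M ^ (card I - 1))" using card\<S> by simp
    also have "\<dots> = (2 ^ card I * L) * M ^ (card I - 1)" by simp
    also have "\<dots> < M * M ^ (card I - 1)" by (intro mult_strict_right_mono) (auto simp: M_def)
    also have "\<dots> = M ^ card I" using I0 by (metis power_minus_mult mult.commute)
    finally show ?thesis using I by (simp add: card_PiE)
  qed
  moreover have "finite (\<Union>S\<in>\<S>. Bad S)"
    using fin\<S> I by (simp add: Bad_def finite_PiE)
  ultimately have "\<not> (I \<rightarrow>\<^sub>E {..<M}) \<subseteq> (\<Union>S\<in>\<S>. Bad S)"
    using card_mono[of "\<Union>S\<in>\<S>. Bad S" "I \<rightarrow>\<^sub>E {..<M}"] by linarith
  then obtain y where y: "y \<in> I \<rightarrow>\<^sub>E {..<M}" "\<And>S. S \<in> \<S> \<Longrightarrow> y \<notin> Bad S"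
    unfolding subset_iff by auto
  show ?thesis
  proof (intro exI[of _ "\<lambda>i. c * real (y i)"] conjI ballI allI impI)
    fix i assume i: "i \<in> I"
    show "0 \<le> c * real (y i)" using c by simp
    have "real (y i) \<le> real M" using y(1) i by (auto simp: PiE_def Pi_def less_imp_le)
    then have "c * real (y i) \<le> c * real M" using c by simp
    also have "\<dots> = \<gamma>" using M by (simp add: c_def)
    finally show "c * real (y i) \<le> \<gamma>" .
  next
    fix S u assume *: "S \<subseteq> I \<and> card S = Suc v \<and> u \<in> coord_space v"
    then have "restrict y S \<notin> Y S" using y unfolding Bad_def \<S>_def by blast
    moreover have "restrict y S \<in> S \<rightarrow>\<^sub>E {..<M}" using y(1) * by auto
    ultimately have "\<not> (\<forall>i\<in>S. f i u + c * real (restrict y S i) = 0)" using * by (auto simp: Y_def)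
    then show "\<exists>i\<in>S. f i u + c * real (y i) \<noteq> 0" by auto
  qed
qed

text \<open>Finiteness of \<open>U\<close> keeps all values at distance \<open>\<mu>\<close> from 0,
  so a generic shift by at most \<open>\<mu> / 2\<close> changes no sign.\<close>

lemma card_sign_patterns_le:
  fixes f :: "'i \<Rightarrow> (nat \<Rightarrow> real) \<Rightarrow> real"
  assumes I: "finite I" and f: "\<And>i. i \<in> I \<Longrightarrow> poly_le v d (f i)"
    and U: "finite U" "U \<subseteq> coord_space v" "\<And>u i. u \<in> U \<Longrightarrow> i \<in> I \<Longrightarrow> f i u \<noteq> 0"
  shows "card ((\<lambda>u. {i \<in> I. f i u > 0}) ` U) \<le> (\<Sum>j\<le>v. (card I choose j) * 2 ^ j) * (2 * d + 1) ^ v"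
proof -
  define \<mu> where "\<mu> = Min (insert 1 ((\<lambda>(u, i). \<bar>f i u\<bar>) ` (U \<times> I)))"
  have \<mu>: "\<mu> > 0" unfolding \<mu>_def using U I by (auto simp: Min_gr_iff)
  have \<mu>_le: "\<mu> \<le> \<bar>f i u\<bar>" if "u \<in> U" "i \<in> I" for u i
    unfolding \<mu>_def using U(1) I that by (intro Min_le) auto
  obtain \<eta> where \<eta>: "\<And>i. i \<in> I \<Longrightarrow> 0 \<le> \<eta> i \<and> \<eta> i \<le> \<mu> / 2"
    "\<And>S u. S \<subseteq> I \<Longrightarrow> card S = Suc v \<Longrightarrow> u \<in> coord_space v \<Longrightarrow> \<exists>i\<in>S. f i u + \<eta> i \<noteq> 0"
    using exists_generic_shift[of I v d f, OF I f half_gt_zero[OF \<mu>]] by metis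
  have sgn: "f i u + \<eta> i \<noteq> 0" "f i u + \<eta> i > 0 \<longleftrightarrow> f i u > 0" if "u \<in> U" "i \<in> I" for u i
    using \<mu>_le[OF that] \<eta>(1)[OF that(2)] \<mu> by auto
  have "card ((\<lambda>u. {i \<in> I. f i u + \<eta> i > 0}) ` U) \<le> (\<Sum>j\<le>v. (card I choose j) * 2 ^ j) * (2 * d + 1) ^ v"
    by (rule card_sign_patterns_general_position[OF I])
      (use f \<eta>(2) U(2) sgn in \<open>auto intro: poly_le.add poly_le.const\<close>)
  moreover have "(\<lambda>u. {i \<in> I. f i u + \<eta> i > 0}) ` U = (\<lambda>u. {i \<in> I. f i u > 0}) ` U"
    by (intro image_cong) (auto simp: sgn)
  ultimately show ?thesis by simp
qed

section \<open>Graphs that can be drawn with few slopes\<close>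

definition ahead :: "nat \<Rightarrow> nat \<Rightarrow> (nat \<Rightarrow> complex) \<Rightarrow> (nat \<Rightarrow> real) \<Rightarrow> (nat \<times> nat \<times> nat) set" where
  "ahead n k p \<alpha> = {(i, j, l). i < n \<and> j < n \<and> l < k \<and> (\<exists>t>0. p j - p i = of_real t * cis (\<alpha> l))}"

text \<open>Depends on the relation alone, not on the drawing, so graphs whose drawings share
  \<open>ahead\<close> take their edges from one common set.\<close>

definition consecutive :: "(nat \<times> nat \<times> nat) set \<Rightarrow> (nat \<times> nat) set" where
  "consecutive R = {(i, j). \<exists>l. (i, j, l) \<in> R \<and> \<not> (\<exists>w. (i, w, l) \<in> R \<and> (w, j, l) \<in> R)}"

text \<open>The components of \<open>z\<close> normal and tangent to the direction; unlike the
  angle, they are polynomial once cosine and sine count as coordinates.\<close>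

lemma pos_multiple_cis_iff:
  "(\<exists>t>0. z = of_real t * cis \<theta>) \<longleftrightarrow>
    Im z * cos \<theta> - Re z * sin \<theta> = 0 \<and> Re z * cos \<theta> + Im z * sin \<theta> > 0"
proof
  assume "\<exists>t>0. z = of_real t * cis \<theta>"
  then obtain t where t: "t > 0" "Re z = t * cos \<theta>" "Im z = t * sin \<theta>" by (auto simp: complex_eq_iff)
  have "Re z * cos \<theta> + Im z * sin \<theta> = t * ((cos \<theta>)\<^sup>2 + (sin \<theta>)\<^sup>2)"
    unfolding t power2_eq_square by (simp only: algebra_simps)
  then show "Im z * cos \<theta> - Re z * sin \<theta> = 0 \<and> Re z * cos \<theta> + Im z * sin \<theta> > 0"
    using t by simp
next
  assume *: "Im z * cos \<theta> - Re z * sin \<theta> = 0 \<and> Re z * cos \<theta> + Im z * sin \<theta> > 0"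
  define t where "t = Re z * cos \<theta> + Im z * sin \<theta>"
  have unit: "(cos \<theta>)\<^sup>2 + (sin \<theta>)\<^sup>2 = 1" by simp
  have zero: "Im z * cos \<theta> - Re z * sin \<theta> = 0" using * by blast
  have "Re z = t * cos \<theta>" "Im z = t * sin \<theta>"
    using unit zero unfolding t_def by algebra+
  then have "z = of_real t * cis \<theta>" by (simp add: complex_eq_iff)
  moreover have "t > 0" using * by (simp add: t_def)
  ultimately show "\<exists>t>0. z = of_real t * cis \<theta>" by blast
qed

text \<open>From \<open>i\<close> in direction \<open>l\<close> only the nearest vertex is
  consecutive, as it blocks the farther ones on the ray; injectivity of \<open>p\<close> excludes
  ties.\<close>

lemma card_consecutive_ahead_le:
  assumes inj: "inj_on p {..<n}"
  shows "finite (consecutive (ahead n k p \<alpha>))" "card (consecutive (ahead n k p \<alpha>)) \<le> n * k"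
proof -
  define R where "R = ahead n k p \<alpha>"
  define nx where "nx = (\<lambda>i l j. (i, j, l) \<in> R \<and> \<not> (\<exists>w. (i, w, l) \<in> R \<and> (w, j, l) \<in> R))"
  have uniq: "j = j'" if "nx i l j" "nx i l j'" for i j j' l
  proof -
    obtain t t' where t: "t > 0" "p j - p i = of_real t * cis (\<alpha> l)"
      "t' > 0" "p j' - p i = of_real t' * cis (\<alpha> l)"
      and bd: "i < n" "j < n" "j' < n" "l < k"
      using \<open>nx i l j\<close> \<open>nx i l j'\<close> unfolding nx_def R_def ahead_def by auto
    have "p j' - p j = of_real (t' - t) * cis (\<alpha> l)" "p j - p j' = of_real (t - t') * cis (\<alpha> l)"
      using t by (simp_all add: algebra_simps)
    then have "t < t' \<Longrightarrow> (j, j', l) \<in> R" "t' < t \<Longrightarrow> (j', j, l) \<in> R"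
      using bd unfolding R_def ahead_def by (auto intro: exI[of _ "t' - t"] exI[of _ "t - t'"])
    then have "t = t'" using that unfolding nx_def by (meson not_less_iff_gr_or_eq)
    then have "p j = p j'" using t by (metis diff_add_cancel)
    then show ?thesis using inj bd by (auto simp: inj_on_def)
  qed
  have sub: "consecutive R \<subseteq> (\<lambda>(i, l). (i, THE j. nx i l j)) ` ({..<n} \<times> {..<k})"
  proof
    fix e assume "e \<in> consecutive R"
    then obtain i j l where e: "e = (i, j)" "nx i l j" unfolding consecutive_def nx_def by auto
    then have "i < n" "l < k" unfolding nx_def R_def ahead_def by auto
    moreover have "(THE j. nx i l j) = j" using e(2) uniq by blast
    ultimately show "e \<in> (\<lambda>(i, l). (i, THE j. nx i l j)) ` ({..<n} \<times> {..<k})"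
      using e by (intro image_eqI[of _ _ "(i, l)"]) auto
  qed
  show "finite (consecutive (ahead n k p \<alpha>))" using finite_subset[OF sub] by (simp add: R_def)
  have "card (consecutive R) \<le> card ((\<lambda>(i, l). (i, THE j. nx i l j)) ` ({..<n} \<times> {..<k}))"
    using sub by (intro card_mono) auto
  also have "\<dots> \<le> card ({..<n} \<times> {..<k})" by (rule card_image_le) simp
  finally show "card (consecutive (ahead n k p \<alpha>)) \<le> n * k" by (simp add: R_def)
qed

lemma slope_eq_multiple:
  assumes "a \<noteq> b"
  shows "\<exists>t::real. t \<noteq> 0 \<and> b - a = of_real t * cis (slope a b)"
proof -
  have "\<exists>t::real. b - a = of_real t * cis (slope a b)"
    using theI'[OF slope_ex1[OF assms]] unfolding slope_def by blast
  then obtain t :: real where t: "b - a = of_real t * cis (slope a b)" by blast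
  moreover have "t \<noteq> 0" using t assms by auto
  ultimately show ?thesis by blast
qed

text \<open>A vertex between \<open>a\<close> and \<open>b\<close> in direction \<open>l\<close>
  would lie on the edge segment, which a drawing forbids.\<close>

lemma edge_consecutive_of_pos:
  assumes d: "drawing G p" and V: "pverts G = {..<n}" and ab: "(a, b) \<in> parcs G" "a < n" "b < n"
    and t: "t > 0" "p b - p a = of_real t * cis (\<alpha> l)" and l: "l < k"
  shows "(a, b) \<in> consecutive (ahead n k p \<alpha>)"
proof -
  have "False" if w: "(a, w, l) \<in> ahead n k p \<alpha>" "(w, b, l) \<in> ahead n k p \<alpha>" for w
  proof -
    obtain s r where sr: "s > 0" "p w - p a = of_real s * cis (\<alpha> l)" "r > 0" "p b - p w = of_real r * cis (\<alpha> l)"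
      "w < n"
      using w unfolding ahead_def by auto
    have "of_real t * cis (\<alpha> l) = of_real (s + r) * cis (\<alpha> l)"
      using sr t by (simp add: algebra_simps)
    then have tsr: "t = s + r" by (simp only: mult_cancel_right of_real_eq_iff cis_neq_zero simp_thms)
    have "p w = (1 - s / t) *\<^sub>R p a + (s / t) *\<^sub>R p b"
    proof -
      have "(1 - s / t) *\<^sub>R p a + (s / t) *\<^sub>R p b = p a + (s / t) *\<^sub>R (p b - p a)"
        by (simp add: algebra_simps)
      also have "\<dots> = p a + of_real s * cis (\<alpha> l)"
        using t by (simp add: scaleR_conv_of_real)
      finally show ?thesis using sr by (simp add: algebra_simps)
    qed
    moreover have "0 \<le> s / t" "s / t \<le> 1" using sr tsr by auto
    ultimately have "p w \<in> closed_segment (p a) (p b)" unfolding closed_segment_def by blast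
    moreover have "w \<noteq> a" "w \<noteq> b" using sr by auto
    ultimately show False using d ab V sr unfolding drawing_def by blast
  qed
  moreover have "(a, b, l) \<in> ahead n k p \<alpha>" using t l ab by (auto simp: ahead_def)
  ultimately show ?thesis unfolding consecutive_def by blast
qed

lemma edge_consecutive:
  assumes G: "pair_graph G" and d: "drawing G p" and V: "pverts G = {..<n}"
    and \<alpha>: "edge_slopes G p \<subseteq> \<alpha> ` {..<k}" and ab: "(a, b) \<in> parcs G"
  shows "(a, b) \<in> consecutive (ahead n k p \<alpha>) \<or> (b, a) \<in> consecutive (ahead n k p \<alpha>)"
proof -
  interpret pair_graph G by fact
  have ba: "(b, a) \<in> parcs G" using ab arcs_symmetric by blast
  have n: "a < n" "b < n" using wellformed'[OF ab] V by auto
  have "a \<noteq> b" using pair_no_loops[OF ab] by simp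
  then have "p a \<noteq> p b" using d n V unfolding drawing_def inj_on_def by auto
  then obtain t where t: "t \<noteq> 0" "p b - p a = of_real t * cis (slope (p a) (p b))"
    using slope_eq_multiple by blast
  have "slope (p a) (p b) \<in> edge_slopes G p" using ab unfolding edge_slopes_def by blast
  then obtain l where l: "l < k" "slope (p a) (p b) = \<alpha> l" using \<alpha> by auto
  show ?thesis
  \<comment> \<open>A slope fixes a direction only up to sign; for negative \<open>t\<close> the
    direction leads from \<open>b\<close> to \<open>a\<close>.\<close>
  proof (cases "t > 0")
    case True
    then show ?thesis using edge_consecutive_of_pos[OF d V ab n] t l by auto
  next
    case False
    then have "p a - p b = of_real (- t) * cis (\<alpha> l)" "- t > 0" using t l by (auto simp: algebra_simps)
    then show ?thesis using edge_consecutive_of_pos[OF d V ba n(2,1)] l by blast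
  qed
qed

lemma orientation_of_edges:
  fixes E :: "(nat \<times> nat) set"
  assumes E: "finite E" "sym E" "irrefl E" "card E = 2 * m"
    and C: "\<And>a b. (a, b) \<in> E \<Longrightarrow> (a, b) \<in> C \<or> (b, a) \<in> C"
  shows "\<exists>A. A \<subseteq> C \<and> card A = m \<and> E = A \<union> A\<inverse>"
proof -
  \<comment> \<open>If both orientations of an edge lie in \<open>C\<close>, the test
    \<open>a < b\<close> keeps just one, so that \<open>A\<close> has one arc per edge.\<close>
  define A where "A = {(a, b) \<in> E. (a, b) \<in> C \<and> (a < b \<or> (b, a) \<notin> C)}"
  have un: "E = A \<union> A\<inverse>"
  proof
    show "E \<subseteq> A \<union> A\<inverse>"
    proof (rule subrelI)
      fix a b assume ab: "(a, b) \<in> E"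
      have "(b, a) \<in> E" using ab E(2) by (auto dest: symD)
      moreover have "a \<noteq> b" using ab E(3) by (auto simp: irrefl_def)
      ultimately show "(a, b) \<in> A \<union> A\<inverse>" using ab C[OF ab] unfolding A_def by auto
    qed
    show "A \<union> A\<inverse> \<subseteq> E" using E(2) by (auto simp: A_def dest: symD)
  qed
  have "A \<inter> A\<inverse> = {}" by (auto simp: A_def)
  moreover have "finite A" using finite_subset[OF _ E(1), of A] by (auto simp: A_def)
  ultimately have "card E = card A + card A" using un by (simp add: card_Un_disjoint)
  then have "card A = m" using E(4) by simp
  moreover have "A \<subseteq> C" by (auto simp: A_def)
  ultimately show ?thesis using un by blast
qed

lemma card_graphs_in_candidates_le:
  fixes \<GG> :: "nat pair_pre_digraph set"
  assumes C: "finite C"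
    and \<GG>: "\<And>G. G \<in> \<GG> \<Longrightarrow> pair_graph G \<and> pverts G = V \<and> card (parcs G) = 2 * m"
    and cand: "\<And>G a b. G \<in> \<GG> \<Longrightarrow> (a, b) \<in> parcs G \<Longrightarrow> (a, b) \<in> C \<or> (b, a) \<in> C"
  shows "card \<GG> \<le> card C choose m"
proof -
  have "\<exists>A. A \<subseteq> C \<and> card A = m \<and> parcs G = A \<union> A\<inverse>" if G: "G \<in> \<GG>" for G
  proof -
    interpret pair_graph G using \<GG>[OF G] by blast
    show ?thesis
    proof (rule orientation_of_edges)
      show "finite (parcs G)" by (rule pair_finite_arcs)
      show "sym (parcs G)" using arcs_symmetric by (auto intro: symI)
      show "irrefl (parcs G)" using pair_no_loops by (force simp: irrefl_def)
    qed (use \<GG>[OF G] cand[OF G] in auto)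
  qed
  then obtain A where A: "\<And>G. G \<in> \<GG> \<Longrightarrow> A G \<subseteq> C" "\<And>G. G \<in> \<GG> \<Longrightarrow> card (A G) = m"
    "\<And>G. G \<in> \<GG> \<Longrightarrow> parcs G = A G \<union> (A G)\<inverse>"
    by metis
  have "inj_on A \<GG>"
  proof (rule inj_onI)
    fix G H assume "G \<in> \<GG>" "H \<in> \<GG>" "A G = A H"
    then have "parcs G = parcs H" "pverts G = pverts H" using A(3) \<GG> by auto
    then show "G = H" by simp
  qed
  moreover have "A ` \<GG> \<subseteq> {B. B \<subseteq> C \<and> card B = m}" using A by auto
  ultimately have "card \<GG> \<le> card {B. B \<subseteq> C \<and> card B = m}" using C by (intro card_inj_on_le) auto
  then show ?thesis using n_subsets[OF C, of m] by simp
qed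

section \<open>Drawings with few slopes as sign patterns of quadratic polynomials\<close>

lemma slope_number_le_witness:
  assumes G: "pair_graph G" and k: "slope_number G \<le> k"
  shows "\<exists>p \<alpha>. drawing G p \<and> edge_slopes G p \<subseteq> \<alpha> ` {..<k}"
proof -
  interpret pair_graph G by fact
  have "{card (edge_slopes G p) | p. drawing G p} \<noteq> {}" using drawing_exists[OF G] by blast
  then have "slope_number G \<in> {card (edge_slopes G p) | p. drawing G p}"
    unfolding slope_number_def by (rule Inf_nat_def1)
  then obtain p where p: "drawing G p" "card (edge_slopes G p) \<le> k" using k by auto
  have "edge_slopes G p = (\<lambda>(u, v). slope (p u) (p v)) ` parcs G" by (auto simp: edge_slopes_def)
  then have "finite (edge_slopes G p)" using pair_finite_arcs by simp
  then obtain \<alpha> where "bij_betw \<alpha> {..<card (edge_slopes G p)} (edge_slopes G p)"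
    using ex_bij_betw_nat_finite by (metis atLeast0LessThan)
  then have "edge_slopes G p = \<alpha> ` {..<card (edge_slopes G p)}" by (simp add: bij_betw_def)
  \<comment> \<open>Padding with arbitrary further values gives every graph exactly \<open>k\<close>
    directions, hence the same number of coordinates.\<close>
  also have "\<dots> \<subseteq> \<alpha> ` {..<k}" using p(2) by (intro image_mono) auto
  finally show ?thesis using p(1) by blast
qed

text \<open>The coordinates of a drawing with \<open>k\<close> slopes: abscissas, ordinates, and the cosines and sines
  of the slopes. The direction vectors are used instead of slope quotients so that vertical edges
  need no special treatment.\<close>

definition drawing_coords :: "nat \<Rightarrow> nat \<Rightarrow> (nat \<Rightarrow> complex) \<Rightarrow> (nat \<Rightarrow> real) \<Rightarrow> nat \<Rightarrow> real" where
  "drawing_coords n k p \<alpha> r =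
    (if r < n then Re (p r) else if r < 2 * n then Im (p (r - n))
     else if r < 2 * n + k then cos (\<alpha> (r - 2 * n))
     else if r < 2 * n + 2 * k then sin (\<alpha> (r - (2 * n + k))) else 0)"

text \<open>The cross product of direction \<open>l\<close> with the displacement from point
  \<open>i\<close> to point \<open>j\<close>, in the layout of \<open>drawing_coords\<close>;
  \<open>tangent_poly\<close> is the inner product.\<close>

definition normal_poly :: "nat \<Rightarrow> nat \<Rightarrow> nat \<Rightarrow> nat \<Rightarrow> nat \<Rightarrow> (nat \<Rightarrow> real) \<Rightarrow> real" where
  "normal_poly n k i j l u = (u (n + j) - u (n + i)) * u (2 * n + l) - (u j - u i) * u (2 * n + k + l)"

definition tangent_poly :: "nat \<Rightarrow> nat \<Rightarrow> nat \<Rightarrow> nat \<Rightarrow> nat \<Rightarrow> (nat \<Rightarrow> real) \<Rightarrow> real" where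
  "tangent_poly n k i j l u = (u j - u i) * u (2 * n + l) + (u (n + j) - u (n + i)) * u (2 * n + k + l)"

lemma poly_le_normal_tangent:
  assumes "i < n" "j < n" "l < k"
  shows "poly_le (2 * n + 2 * k) 2 (normal_poly n k i j l)" "poly_le (2 * n + 2 * k) 2 (tangent_poly n k i j l)"
proof -
  have v: "poly_le (2 * n + 2 * k) 1 (\<lambda>u. u r)" if "r < 2 * n + 2 * k" for r
    using that by (intro poly_le.var) auto
  have m: "poly_le (2 * n + 2 * k) 2 (\<lambda>u. (u a - u b) * u c)"
    if "a < 2 * n + 2 * k" "b < 2 * n + 2 * k" "c < 2 * n + 2 * k" for a b c
    by (rule poly_le.mult[of _ 1 _ 1]) (use v that poly_le_diff in auto)
  show "poly_le (2 * n + 2 * k) 2 (normal_poly n k i j l)"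
    unfolding normal_poly_def[abs_def] using assms by (intro poly_le_diff m) auto
  show "poly_le (2 * n + 2 * k) 2 (tangent_poly n k i j l)"
    unfolding tangent_poly_def[abs_def] using assms by (intro poly_le.add m) auto
qed

lemma ahead_iff_poly:
  assumes "i < n" "j < n" "l < k"
  shows "(i, j, l) \<in> ahead n k p \<alpha> \<longleftrightarrow> normal_poly n k i j l (drawing_coords n k p \<alpha>) = 0 \<and>
    tangent_poly n k i j l (drawing_coords n k p \<alpha>) > 0"
  using assms pos_multiple_cis_iff[of "p j - p i" "\<alpha> l"]
  by (simp add: ahead_def normal_poly_def tangent_poly_def drawing_coords_def)

text \<open>Each triple contributes three polynomials of degree 2, two for the equation and one for
  the inequality; this is the origin of \<open>3 * n * n * k\<close> and of
  \<open>5 = 2 * 2 + 1\<close>.\<close>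

lemma card_ahead_relations_le:
  assumes P: "finite P"
  shows "card ((\<lambda>(p, \<alpha>). ahead n k p \<alpha>) ` P)
    \<le> (\<Sum>j\<le>2 * n + 2 * k. (3 * n * n * k choose j) * 2 ^ j) * 5 ^ (2 * n + 2 * k)"
proof -
  define U where "U = (\<lambda>(p, \<alpha>). drawing_coords n k p \<alpha>) ` P"
  define T where "T = {..<n} \<times> {..<n} \<times> {..<k}"
  define vals where "vals = (\<lambda>((i, j, l), u). \<bar>normal_poly n k i j l u\<bar>) ` (T \<times> U) \<union>
    (\<lambda>((i, j, l), u). \<bar>tangent_poly n k i j l u\<bar>) ` (T \<times> U)"
  \<comment> \<open>Half the least nonzero absolute value attained; the inserted 1 covers the case
    that there is none.\<close>
  define \<eta> where "\<eta> = Min (insert 1 (vals - {0})) / 2"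
  have finU: "finite U" using P by (simp add: U_def)
  have fin: "finite (insert 1 (vals - {0}))" using finU by (simp add: vals_def T_def)
  have "vals - {0} \<subseteq> {0<..}" by (auto simp: vals_def)
  then have "Min (insert 1 (vals - {0})) > 0" using fin by (auto simp: Min_gr_iff)
  then have \<eta>0: "\<eta> > 0" by (simp add: \<eta>_def)
  have \<eta>_less: "\<eta> < x" if "x \<in> vals" "x \<noteq> 0" for x
  proof -
    have "Min (insert 1 (vals - {0})) \<le> x" using fin that by (intro Min_le) auto
    then show ?thesis using \<eta>0 by (simp add: \<eta>_def)
  qed
  have \<eta>N: "\<eta> < \<bar>normal_poly n k i j l u\<bar>" if "(i, j, l) \<in> T" "u \<in> U" "normal_poly n k i j l u \<noteq> 0" for i j l u
    using that by (intro \<eta>_less) (force simp: vals_def)+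
  have \<eta>T: "\<eta> < \<bar>tangent_poly n k i j l u\<bar>" if "(i, j, l) \<in> T" "u \<in> U" "tangent_poly n k i j l u \<noteq> 0" for i j l u
    using that by (intro \<eta>_less) (force simp: vals_def)+
  \<comment> \<open>On the finite set \<open>U\<close> the strict signs of \<open>P - \<eta>\<close> and \<open>P + \<eta>\<close> decide whether \<open>P\<close> vanishes.\<close>
  define I where "I = {..<3::nat} \<times> T"
  define f where "f = (\<lambda>(c::nat, i, j, l) u.
    if c = 0 then normal_poly n k i j l u - \<eta> else if c = 1 then normal_poly n k i j l u + \<eta>
    else tangent_poly n k i j l u - \<eta>)"
  define dec where "dec = (\<lambda>S :: (nat \<times> nat \<times> nat \<times> nat) set. {x \<in> T. (0, x) \<notin> S \<and> (1, x) \<in> S \<and> (2, x) \<in> S})"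
  have cardI: "card I = 3 * n * n * k" by (simp add: I_def T_def card_cartesian_product)
  have "card ((\<lambda>u. {x \<in> I. f x u > 0}) ` U)
      \<le> (\<Sum>j\<le>2 * n + 2 * k. (card I choose j) * 2 ^ j) * (2 * 2 + 1) ^ (2 * n + 2 * k)"
  proof (rule card_sign_patterns_le[OF _ _ finU])
    show "finite I" by (simp add: I_def T_def)
    show "U \<subseteq> coord_space (2 * n + 2 * k)" by (auto simp: U_def coord_space_def drawing_coords_def)
    fix x assume "x \<in> I"
    then obtain c i j l where x: "x = (c, i, j, l)" "(i, j, l) \<in> T" "i < n" "j < n" "l < k"
      unfolding I_def T_def by auto
    consider "c = 0" | "c = 1" | "c \<noteq> 0" "c \<noteq> 1" by blast
    then show "poly_le (2 * n + 2 * k) 2 (f x)"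
      by cases (simp_all add: f_def x poly_le_diff poly_le.add poly_le.const poly_le_normal_tangent)
    fix u assume u: "u \<in> U"
    show "f x u \<noteq> 0"
      using \<eta>N[OF x(2) u] \<eta>T[OF x(2) u] \<eta>0 by (auto simp: f_def x split: if_splits)
  qed
  moreover have "(\<lambda>(p, \<alpha>). ahead n k p \<alpha>) ` P = dec ` (\<lambda>u. {x \<in> I. f x u > 0}) ` U"
  proof -
    have "ahead n k p \<alpha> = dec {x \<in> I. f x (drawing_coords n k p \<alpha>) > 0}" if "(p, \<alpha>) \<in> P" for p \<alpha>
    proof -
      define u where "u = drawing_coords n k p \<alpha>"
      have u: "u \<in> U" using that by (force simp: U_def u_def)
      have "x \<in> ahead n k p \<alpha> \<longleftrightarrow> x \<in> dec {x \<in> I. f x u > 0}" for x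
      proof (cases "x \<in> T")
        case False
        then show ?thesis by (auto simp: dec_def ahead_def T_def)
      next
        case True
        then obtain i j l where x: "x = (i, j, l)" "(i, j, l) \<in> T" "i < n" "j < n" "l < k"
          unfolding T_def by auto
        have "x \<in> dec {x \<in> I. f x u > 0} \<longleftrightarrow> \<not> f (0, x) u > 0 \<and> f (1, x) u > 0 \<and> f (2, x) u > 0"
          using True by (simp add: dec_def I_def)
        also have "\<dots> \<longleftrightarrow> normal_poly n k i j l u = 0 \<and> tangent_poly n k i j l u > 0"
          using \<eta>N[OF x(2) u] \<eta>T[OF x(2) u] \<eta>0
          by (cases "normal_poly n k i j l u = 0") (auto simp: f_def x(1))
        finally show ?thesis using ahead_iff_poly[OF x(3-5)] by (simp add: u_def x(1))
      qed
      then show ?thesis unfolding u_def by blast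
    qed
    then show ?thesis unfolding U_def image_image by (intro image_cong) auto
  qed
  moreover have "card (dec ` (\<lambda>u. {x \<in> I. f x u > 0}) ` U) \<le> card ((\<lambda>u. {x \<in> I. f x u > 0}) ` U)"
    using finU by (intro card_image_le) simp
  ultimately show ?thesis by (simp add: cardI)
qed

text \<open>One drawing per graph is fixed and the graphs are grouped by its \<open>ahead\<close>
  relation; each graph of a group is given by \<open>m\<close> of the same at most
  \<open>n * k\<close> consecutive pairs.\<close>

lemma card_graphs_few_slopes_le:
  fixes \<GG> :: "nat pair_pre_digraph set"
  assumes fin: "finite \<GG>"
    and \<GG>: "\<And>G. G \<in> \<GG> \<Longrightarrow> pair_graph G \<and> pverts G = {..<n} \<and> card (parcs G) = 2 * m"
    and k: "\<And>G. G \<in> \<GG> \<Longrightarrow> slope_number G \<le> k"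
  shows "card \<GG> \<le> (\<Sum>j\<le>2 * n + 2 * k. (3 * n * n * k choose j) * 2 ^ j) * 5 ^ (2 * n + 2 * k) *
    (n * k choose m)"
proof -
  have "\<exists>p \<alpha>. drawing G p \<and> edge_slopes G p \<subseteq> \<alpha> ` {..<k}" if "G \<in> \<GG>" for G
    using slope_number_le_witness \<GG>[OF that] k[OF that] by blast
  then obtain p \<alpha> where p: "\<And>G. G \<in> \<GG> \<Longrightarrow> drawing G (p G)"
    and \<alpha>: "\<And>G. G \<in> \<GG> \<Longrightarrow> edge_slopes G (p G) \<subseteq> \<alpha> G ` {..<k}"
    by metis
  define key where "key = (\<lambda>G. ahead n k (p G) (\<alpha> G))"
  have "key ` \<GG> = (\<lambda>(p, \<alpha>). ahead n k p \<alpha>) ` (\<lambda>G. (p G, \<alpha> G)) ` \<GG>"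
    by (simp add: key_def image_image)
  then have card_key: "card (key ` \<GG>)
      \<le> (\<Sum>j\<le>2 * n + 2 * k. (3 * n * n * k choose j) * 2 ^ j) * 5 ^ (2 * n + 2 * k)"
    using card_ahead_relations_le[of "(\<lambda>G. (p G, \<alpha> G)) ` \<GG>" n k] fin by simp
  show ?thesis
  proof (rule card_le_fibers_bound[OF _ card_key order_refl])
    show "finite (key ` \<GG>)" using fin by simp
    fix R assume "R \<in> key ` \<GG>"
    then obtain H where H: "H \<in> \<GG>" "R = key H" by blast
    have "inj_on (p H) {..<n}" using p[OF H(1)] \<GG>[OF H(1)] unfolding drawing_def by auto
    then have R: "finite (consecutive R)" "card (consecutive R) \<le> n * k"
      using card_consecutive_ahead_le by (auto simp: H(2) key_def)
    have "card {G \<in> \<GG>. key G = R} \<le> card (consecutive R) choose m"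
    proof (rule card_graphs_in_candidates_le[OF R(1)])
      fix G a b assume G: "G \<in> {G \<in> \<GG>. key G = R}" and ab: "(a, b) \<in> parcs G"
      then show "(a, b) \<in> consecutive R \<or> (b, a) \<in> consecutive R"
        using edge_consecutive[of G "p G" n "\<alpha> G" k a b] p \<alpha> \<GG> by (auto simp: key_def)
    qed (use \<GG> in auto)
    also have "\<dots> \<le> n * k choose m" by (rule binomial_right_mono[OF R(2)])
    finally show "card {G \<in> \<GG>. key G = R} \<le> n * k choose m" .
  qed
qed

section \<open>Lifts of complete bipartite graphs\<close>

lemma regular_graphI:
  fixes E :: "(nat \<times> nat) set"
  assumes E: "E \<subseteq> {..<n} \<times> {..<n}" "sym E" "irrefl E" and deg: "\<And>a. a < n \<Longrightarrow> card {b. (a, b) \<in> E} = d"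
  shows "regular_graph d \<lparr>pverts = {..<n}, parcs = E\<rparr>"
proof -
  have "finite E" using E(1) finite_subset by blast
  then have "pair_graph \<lparr>pverts = {..<n}, parcs = E\<rparr>"
    using E by unfold_locales (auto simp: symmetric_def irrefl_def)
  moreover have "out_degree (with_proj \<lparr>pverts = {..<n}, parcs = E\<rparr>) a = d" if "a < n" for a
  proof -
    have "out_arcs (with_proj \<lparr>pverts = {..<n}, parcs = E\<rparr>) a = Pair a ` {b. (a, b) \<in> E}"
      by (auto simp: out_arcs_def)
    then show ?thesis using deg[OF that] by (simp add: out_degree_def card_image inj_on_def)
  qed
  ultimately show ?thesis by (simp add: regular_graph_def)
qed

lemma card_parcs_regular:
  assumes "regular_graph d G"
  shows "card (parcs G) = card (pverts G) * d"
proof -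
  interpret pair_graph G using assms by (simp add: regular_graph_def)
  have "parcs G = (\<Union>v\<in>pverts G. out_arcs (with_proj G) v)"
    using wellformed' by (auto simp: out_arcs_def)
  then have "card (parcs G) = (\<Sum>v\<in>pverts G. card (out_arcs (with_proj G) v))"
    using pair_finite_verts pair_finite_arcs
    by (subst (1) \<open>parcs G = _\<close>) (intro card_UN_disjoint, auto simp: out_arcs_def)
  also have "\<dots> = (\<Sum>v\<in>pverts G. d)"
    using assms by (intro sum.cong) (auto simp: regular_graph_def out_degree_def)
  finally show ?thesis by simp
qed

text \<open>The neighbours of \<open>a\<close> are \<open>a + d\<close> modulo \<open>r\<close> for
  \<open>d\<close> in \<open>S\<close>: closure under \<open>d \<mapsto> r - d\<close> handles the
  wraparound, and as 0 is not in \<open>S\<close>, truncated differences add no spurious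
  neighbour.\<close>

lemma circulant_degree:
  fixes S :: "nat set"
  assumes S: "S \<subseteq> {1..<r}" "\<And>d. d \<in> S \<Longrightarrow> r - d \<in> S" and a: "a < r"
  shows "card {b. b < r \<and> (b - a \<in> S \<or> a - b \<in> S)} = card S"
proof -
  have S1: "1 \<le> d \<and> d < r" if "d \<in> S" for d using S(1) that by auto
  have "bij_betw (\<lambda>d. if a + d < r then a + d else a + d - r) S {b. b < r \<and> (b - a \<in> S \<or> a - b \<in> S)}"
  proof (rule bij_betw_byWitness[where f' = "\<lambda>b. if a < b then b - a else b + r - a"])
    show "\<forall>d\<in>S. (if a < (if a + d < r then a + d else a + d - r)
        then (if a + d < r then a + d else a + d - r) - a
        else (if a + d < r then a + d else a + d - r) + r - a) = d"
      using S1 a by (auto dest!: S1)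
    show "\<forall>b\<in>{b. b < r \<and> (b - a \<in> S \<or> a - b \<in> S)}.
        (if a + (if a < b then b - a else b + r - a) < r then a + (if a < b then b - a else b + r - a)
         else a + (if a < b then b - a else b + r - a) - r) = b"
      using a by auto
    have "a + d - r - a \<in> S \<or> a - (a + d - r) \<in> S" if "d \<in> S" "\<not> a + d < r" for d
    proof -
      have "a - (a + d - r) = r - d" using that S1[OF that(1)] by simp
      then show ?thesis using S(2)[OF that(1)] by simp
    qed
    then show "(\<lambda>d. if a + d < r then a + d else a + d - r) ` S \<subseteq> {b. b < r \<and> (b - a \<in> S \<or> a - b \<in> S)}"
      using S1 S(2) a by (auto dest: S1)
    have "b + r - a \<in> S" if "b - a \<in> S \<or> a - b \<in> S" "\<not> a < b" for b
    proof -
      have "a - b \<in> S" using that S1[of 0] by auto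
      moreover have "b + r - a = r - (a - b)" using that a by simp
      ultimately show ?thesis using S(2) by metis
    qed
    moreover have "b - a \<in> S" if "b - a \<in> S \<or> a - b \<in> S" "a < b" for b
      using that S1[of 0] by auto
    ultimately show "(\<lambda>b. if a < b then b - a else b + r - a) ` {b. b < r \<and> (b - a \<in> S \<or> a - b \<in> S)} \<subseteq> S"
      by auto
  qed
  then show ?thesis by (simp add: bij_betw_same_card)
qed

lemma circulant_exists:
  assumes r: "2 * d \<le> r" "0 < d" and even: "even (r * d)"
  shows "\<exists>E. E \<subseteq> {..<r} \<times> {..<r} \<and> sym E \<and> irrefl E \<and> (\<forall>a<r. card {b. (a, b) \<in> E} = d)"
proof -
  define h where "h = d div 2"
  have h: "2 * h < r" using r by (auto simp: h_def)
  \<comment> \<open>Steps of length up to \<open>h\<close> in both directions; for odd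
    \<open>d\<close> also the antipode \<open>r div 2\<close>, where \<open>r\<close> is even by the
    parity assumption.\<close>
  define S where "S = {1..h} \<union> {r - h..<r} \<union> (if odd d then {r div 2} else {})"
  have S: "S \<subseteq> {1..<r}" using r by (auto simp: S_def h_def)
  have Sr: "r - x \<in> S" if x: "x \<in> S" for x
  proof -
    consider "x \<in> {1..h}" | "x \<in> {r - h..<r}" | "odd d" "x = r div 2"
      using x by (auto simp: S_def split: if_splits)
    then show ?thesis
    proof cases
      case 1
      then have "r - x \<in> {r - h..<r}" using h by auto
      then show ?thesis by (simp add: S_def)
    next
      case 2
      then have "r - x \<in> {1..h}" by auto
      then show ?thesis by (simp add: S_def)
    next
      case 3
      then have "r - x = r div 2" using even by auto
      then show ?thesis using 3 by (simp add: S_def)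
    qed
  qed
  have "card S = d"
  proof -
    have "{1..h} \<inter> {r - h..<r} = {}" using r by (auto simp: h_def)
    then have c: "card ({1..h} \<union> {r - h..<r}) = h + h" using r by (simp add: card_Un_disjoint h_def)
    show ?thesis
    proof (cases "odd d")
      case True
      then have "even r" using even by simp
      then have "r div 2 \<notin> {1..h} \<union> {r - h..<r}" using r True unfolding h_def by (auto elim!: oddE evenE)
      then have "card S = h + h + 1" using c True by (simp add: S_def)
      then show ?thesis using True by (simp add: h_def odd_two_times_div_two_succ flip: mult_2)
    next
      case False
      then show ?thesis using c by (simp add: S_def h_def flip: mult_2)
    qed
  qed
  define E where "E = {(a, b). a < r \<and> b < r \<and> (b - a \<in> S \<or> a - b \<in> S)}"
  have "card {b. (a, b) \<in> E} = d" if "a < r" for a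
    using circulant_degree[OF S Sr that] that \<open>card S = d\<close> by (simp add: E_def)
  moreover have "sym E" by (auto simp: E_def sym_def)
  moreover have "irrefl E" using S by (auto simp: E_def irrefl_def)
  ultimately show ?thesis by (intro exI[of _ E]) (auto simp: E_def)
qed

section \<open>Lifts, with vertices indexed by block and position\<close>

lemma block_index_eq:
  fixes b :: nat
  assumes "x < b" "y < b"
  shows "c * b + x = c' * b + y \<longleftrightarrow> c = c' \<and> x = y"
proof
  assume eq: "c * b + x = c' * b + y"
  have "c = (c * b + x) div b" "c' = (c' * b + y) div b" using assms by auto
  then show "c = c' \<and> x = y" using eq by auto
qed auto

lemma block_index_less: "(c::nat) < d \<Longrightarrow> x < b \<Longrightarrow> c * b + x < d * b"
  by (metis add_less_cancel_left add.commute less_le_trans mult_Suc mult_le_mono1 Suc_leI)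

lemma block_index_cases:
  fixes a :: nat
  assumes "a < d * b"
  obtains c x where "c < d" "x < b" "a = c * b + x"
proof
  show "a div b < d" using assms by (simp add: less_mult_imp_div_less)
  show "a mod b < b" using assms by (cases "b = 0") auto
qed simp

text \<open>A lift of the complete bipartite graph: the vertices of each side form \<open>d\<close> blocks of size \<open>b\<close>,
  and the blocks \<open>c\<close> and \<open>c'\<close> of different sides are joined by the perfect matching \<open>\<pi> (c, c')\<close>.\<close>

definition lift_arcs :: "nat \<Rightarrow> nat \<Rightarrow> (nat \<times> nat \<Rightarrow> nat \<Rightarrow> nat) \<Rightarrow> (nat \<times> nat) set" where
  "lift_arcs d b \<pi> = {(c * b + x, d * b + (c' * b + \<pi> (c, c') x)) | c c' x. c < d \<and> c' < d \<and> x < b}"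

lemma lift_arcs_iff:
  assumes \<pi>: "\<And>c c'. c < d \<Longrightarrow> c' < d \<Longrightarrow> \<pi> (c, c') permutes {..<b}"
    and "c < d" "c' < d" "x < b" "y < b"
  shows "(c * b + x, d * b + (c' * b + y)) \<in> lift_arcs d b \<pi> \<longleftrightarrow> \<pi> (c, c') x = y"
proof -
  have less: "\<pi> (c, c') x < b" if "c < d" "c' < d" "x < b" for c c' x
    using permutes_in_image[OF \<pi>[OF that(1,2)], of x] that(3) by simp
  show ?thesis
  proof
    assume "(c * b + x, d * b + (c' * b + y)) \<in> lift_arcs d b \<pi>"
    then obtain e e' z where e: "e < d" "e' < d" "z < b" "c * b + x = e * b + z" "c' * b + y = e' * b + \<pi> (e, e') z"
      unfolding lift_arcs_def by auto
    have "c = e \<and> x = z" using block_index_eq e(3,4) assms(4) by blast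
    moreover have "c' = e' \<and> y = \<pi> (e, e') z" using block_index_eq e(5) assms(5) less[OF e(1-3)] by blast
    ultimately show "\<pi> (c, c') x = y" by simp
  next
    assume "\<pi> (c, c') x = y"
    then show "(c * b + x, d * b + (c' * b + y)) \<in> lift_arcs d b \<pi>"
      using assms unfolding lift_arcs_def by blast
  qed
qed

lemma lift_arcs_subset:
  assumes \<pi>: "\<And>c c'. c < d \<Longrightarrow> c' < d \<Longrightarrow> \<pi> (c, c') permutes {..<b}"
  shows "lift_arcs d b \<pi> \<subseteq> {..<d * b} \<times> {d * b..<2 * (d * b)}"
proof -
  have "\<pi> (c, c') x < b" if "c < d" "c' < d" "x < b" for c c' x
    using permutes_in_image[OF \<pi>[OF that(1,2)], of x] that(3) by simp
  then have "c * b + x < d * b" "c' * b + \<pi> (c, c') x < d * b" if "c < d" "c' < d" "x < b" for c c' x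
    using block_index_less that by blast+
  then show ?thesis unfolding lift_arcs_def by (auto simp: mult.commute[of d b])
qed

lemma card_lift_out:
  assumes \<pi>: "\<And>c c'. c < d \<Longrightarrow> c' < d \<Longrightarrow> \<pi> (c, c') permutes {..<b}" and a: "a < d * b"
  shows "card {w. (a, w) \<in> lift_arcs d b \<pi>} = d"
proof -
  obtain c x where c: "c < d" "x < b" "a = c * b + x" using a by (rule block_index_cases)
  have less: "\<pi> (c, c') x < b" if "c' < d" for c'
    using permutes_in_image[OF \<pi>[OF c(1) that], of x] c(2) by simp
  have "{w. (a, w) \<in> lift_arcs d b \<pi>} = (\<lambda>c'. d * b + (c' * b + \<pi> (c, c') x)) ` {..<d}"
  proof (intro equalityI subsetI)
    fix w assume "w \<in> {w. (a, w) \<in> lift_arcs d b \<pi>}"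
    then obtain e e' z where e: "e < d" "e' < d" "z < b" "c * b + x = e * b + z" "w = d * b + (e' * b + \<pi> (e, e') z)"
      unfolding lift_arcs_def c(3) by auto
    have "c = e \<and> x = z" using block_index_eq e(3,4) c(2) by blast
    then show "w \<in> (\<lambda>c'. d * b + (c' * b + \<pi> (c, c') x)) ` {..<d}" using e by auto
  next
    fix w assume "w \<in> (\<lambda>c'. d * b + (c' * b + \<pi> (c, c') x)) ` {..<d}"
    then show "w \<in> {w. (a, w) \<in> lift_arcs d b \<pi>}" using c unfolding lift_arcs_def by auto
  qed
  moreover have "inj_on (\<lambda>c'. d * b + (c' * b + \<pi> (c, c') x)) {..<d}"
    by (rule inj_onI) (use less block_index_eq in \<open>auto\<close>)
  ultimately show ?thesis by (simp add: card_image)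
qed

lemma card_lift_in:
  assumes \<pi>: "\<And>c c'. c < d \<Longrightarrow> c' < d \<Longrightarrow> \<pi> (c, c') permutes {..<b}" and a: "a < d * b"
  shows "card {w. (w, d * b + a) \<in> lift_arcs d b \<pi>} = d"
proof -
  obtain c' y where c': "c' < d" "y < b" "a = c' * b + y" using a by (rule block_index_cases)
  define g where "g = (\<lambda>c. inv (\<pi> (c, c')) y)"
  have g: "g c < b" "\<pi> (c, c') (g c) = y" if "c < d" for c
    using permutes_in_image[OF permutes_inv[OF \<pi>[OF that c'(1)]], of y] c'(2)
      permutes_inverses(1)[OF \<pi>[OF that c'(1)]] by (auto simp: g_def)
  have "{w. (w, d * b + a) \<in> lift_arcs d b \<pi>} = (\<lambda>c. c * b + g c) ` {..<d}"
  proof (intro equalityI subsetI)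
    fix w assume w: "w \<in> {w. (w, d * b + a) \<in> lift_arcs d b \<pi>}"
    then have "w < d * b" using lift_arcs_subset[of d \<pi> b, OF \<pi>] by auto
    then obtain c x where c: "c < d" "x < b" "w = c * b + x" by (rule block_index_cases)
    have "\<pi> (c, c') x = y" using lift_arcs_iff[of d \<pi> b, OF \<pi> c(1) c'(1) c(2) c'(2)] w c c' by simp
    then have "x = g c"
      using permutes_inverses(2)[OF \<pi>[OF c(1) c'(1)], of x] by (simp add: g_def)
    then show "w \<in> (\<lambda>c. c * b + g c) ` {..<d}" using c by auto
  next
    fix w assume "w \<in> (\<lambda>c. c * b + g c) ` {..<d}"
    then obtain c where c: "c < d" "w = c * b + g c" by auto
    then show "w \<in> {w. (w, d * b + a) \<in> lift_arcs d b \<pi>}"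
      using lift_arcs_iff[of d \<pi> b, OF \<pi> c(1) c'(1) g(1)[OF c(1)] c'(2)] g(2)[OF c(1)] c'(3) by simp
  qed
  moreover have "inj_on (\<lambda>c. c * b + g c) {..<d}"
    by (rule inj_onI) (use g(1) block_index_eq in auto)
  ultimately show ?thesis by (simp add: card_image)
qed

text \<open>The \<open>r \<ge> 2 * d\<close> vertices outside the lift carry the same circulant
  graph throughout. The permutations can be read off from the arcs between the two sides, so
  distinct choices give distinct graphs.\<close>

lemma many_regular_graphs:
  assumes d: "0 < d" and n: "2 * d * (b + 1) \<le> n" and even: "even (n * d)"
  shows "\<exists>\<GG> :: nat pair_pre_digraph set. finite \<GG> \<and> card \<GG> = fact b ^ (d * d) \<and>
    (\<forall>G\<in>\<GG>. regular_graph d G \<and> pverts G = {..<n})"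
proof -
  define N where "N = d * b"
  define r where "r = n - 2 * N"
  have nr: "n = 2 * N + r" "2 * d \<le> r" using n by (auto simp: N_def r_def algebra_simps)
  have "even (r * d)" using even by (simp add: nr(1))
  then obtain E0 where E0: "E0 \<subseteq> {..<r} \<times> {..<r}" "sym E0" "irrefl E0" "\<And>a. a < r \<Longrightarrow> card {b. (a, b) \<in> E0} = d"
    using circulant_exists[OF nr(2) d] by blast
  define E1 where "E1 = map_prod ((+) (2 * N)) ((+) (2 * N)) ` E0"
  define E where "E = (\<lambda>\<pi>. lift_arcs d b \<pi> \<union> (lift_arcs d b \<pi>)\<inverse> \<union> E1)"
  define Perms where "Perms = ({..<d} \<times> {..<d}) \<rightarrow>\<^sub>E {\<pi>. \<pi> permutes {..<b}}"
  have Perms: "\<pi> (c, c') permutes {..<b}" if "\<pi> \<in> Perms" "c < d" "c' < d" for \<pi> c c'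
    using that unfolding Perms_def by (auto simp: PiE_def Pi_def)
  have L: "lift_arcs d b \<pi> \<subseteq> {..<N} \<times> {N..<2 * N}" if "\<pi> \<in> Perms" for \<pi>
    using lift_arcs_subset[of d \<pi> b, OF Perms[OF that]] by (simp add: N_def)
  have E1: "E1 \<subseteq> {2 * N..<n} \<times> {2 * N..<n}" using E0(1) by (auto simp: E1_def nr(1))
  have reg: "regular_graph d \<lparr>pverts = {..<n}, parcs = E \<pi>\<rparr>" if \<pi>: "\<pi> \<in> Perms" for \<pi>
  proof (rule regular_graphI)
    show "E \<pi> \<subseteq> {..<n} \<times> {..<n}" using L[OF \<pi>] E1 nr(1) unfolding E_def by fastforce
    have "sym E1" using E0(2) unfolding E1_def sym_def by force
    then show "sym (E \<pi>)" unfolding E_def by (auto simp: sym_def)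
    have "irrefl E1" using E0(3) unfolding E1_def irrefl_def by auto
    then show "irrefl (E \<pi>)" using L[OF \<pi>] unfolding E_def irrefl_def by fastforce
    fix a assume "a < n"
    then consider "a < N" | "N \<le> a" "a < 2 * N" | "2 * N \<le> a" by linarith
    then show "card {w. (a, w) \<in> E \<pi>} = d"
    proof cases
      case 1
      then have "{w. (a, w) \<in> E \<pi>} = {w. (a, w) \<in> lift_arcs d b \<pi>}" using L[OF \<pi>] E1 unfolding E_def by fastforce
      then show ?thesis using card_lift_out[of d \<pi> b a, OF Perms[OF \<pi>]] 1 by (simp add: N_def)
    next
      case 2
      then have "{w. (a, w) \<in> E \<pi>} = {w. (w, d * b + (a - N)) \<in> lift_arcs d b \<pi>}"
        using L[OF \<pi>] E1 unfolding E_def N_def[symmetric] by fastforce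
      then show ?thesis using card_lift_in[of d \<pi> b "a - N", OF Perms[OF \<pi>]] 2 by (simp add: N_def)
    next
      case 3
      then have "{w. (a, w) \<in> E \<pi>} = (+) (2 * N) ` {w. (a - 2 * N, w) \<in> E0}"
        using L[OF \<pi>] unfolding E_def E1_def by (auto simp: image_iff) fastforce+
      then show ?thesis using E0(4)[of "a - 2 * N"] 3 \<open>a < n\<close> nr(1) by (simp add: card_image)
    qed
  qed
  have inj: "inj_on (\<lambda>\<pi>. \<lparr>pverts = {..<n}, parcs = E \<pi>\<rparr>) Perms"
  proof (rule inj_onI)
    fix \<pi> \<rho> assume \<pi>: "\<pi> \<in> Perms" and \<rho>: "\<rho> \<in> Perms"
      and "\<lparr>pverts = {..<n}, parcs = E \<pi>\<rparr> = \<lparr>pverts = {..<n}, parcs = E \<rho>\<rparr>"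
    then have "E \<pi> = E \<rho>" by simp
    moreover have "lift_arcs d b \<tau> = E \<tau> \<inter> {..<N} \<times> {N..<2 * N}" if "\<tau> \<in> Perms" for \<tau>
      using L[OF that] E1 unfolding E_def by fastforce
    ultimately have eq: "lift_arcs d b \<pi> = lift_arcs d b \<rho>" using \<pi> \<rho> by simp
    show "\<pi> = \<rho>"
    proof (rule PiE_ext[OF \<pi>[unfolded Perms_def] \<rho>[unfolded Perms_def]])
      fix q assume "q \<in> {..<d} \<times> {..<d}"
      then obtain c c' where q: "q = (c, c')" "c < d" "c' < d" by auto
      show "\<pi> q = \<rho> q"
      proof
        fix x
        show "\<pi> q x = \<rho> q x"
        proof (cases "x < b")
          case True
          have y: "\<pi> (c, c') x < b" using permutes_in_image[OF Perms[OF \<pi> q(2,3)], of x] True by simp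
          have "(c * b + x, d * b + (c' * b + \<pi> (c, c') x)) \<in> lift_arcs d b \<pi>"
            using lift_arcs_iff[of d \<pi> b, OF Perms[OF \<pi>] q(2,3) True y] by simp
          then show ?thesis
            using lift_arcs_iff[of d \<rho> b, OF Perms[OF \<rho>] q(2,3) True y] eq q(1) by simp
        next
          case False
          then show ?thesis using Perms[OF \<pi> q(2,3)] Perms[OF \<rho> q(2,3)] q(1) by (simp add: permutes_not_in)
        qed
      qed
    qed
  qed
  have "finite {\<pi>. \<pi> permutes {..<b}}" by (rule finite_permutations) simp
  then have "finite Perms" unfolding Perms_def by (intro finite_PiE) auto
  moreover have "card Perms = fact b ^ (d * d)"
    unfolding Perms_def by (simp add: card_PiE card_permutations[of "{..<b}" b] card_cartesian_product)
  ultimately show ?thesis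
    using reg inj by (intro exI[of _ "(\<lambda>\<pi>. \<lparr>pverts = {..<n}, parcs = E \<pi>\<rparr>) ` Perms"]) (auto simp: card_image)
qed

section \<open>Comparison of the two counts\<close>

lemma power_div_fact_le_exp:
  fixes x :: real
  assumes "0 \<le> x"
  shows "x ^ n / fact n \<le> exp x"
proof -
  have "sum (\<lambda>k. x ^ k /\<^sub>R fact k) {n} \<le> (\<Sum>k. x ^ k /\<^sub>R fact k)"
    using assms summable_exp_generic[of x] by (intro sum_le_suminf) auto
  then show ?thesis by (simp add: exp_def divide_inverse mult.commute)
qed

text \<open>The weak Stirling bound \<open>(b / e) ^ b\<close>, from a single term of the
  exponential series.\<close>

lemma fact_ge_exp:
  assumes "0 < b"
  shows "exp (real b * (ln (real b) - 1)) \<le> fact b"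
proof -
  have "exp (real b * ln (real b)) = real b ^ b" using assms by (simp add: exp_of_nat_mult)
  moreover have "real b ^ b \<le> exp (real b) * fact b"
    using power_div_fact_le_exp[of "real b" b] by (simp add: divide_le_eq)
  ultimately show ?thesis by (simp add: right_diff_distrib exp_diff divide_le_eq mult.commute)
qed

text \<open>The familiar bound \<open>(e * N / m) ^ m\<close> in exponential form.\<close>

lemma choose_le_exp:
  assumes "0 < m" "0 < N"
  shows "real (N choose m) \<le> exp (real m * (1 + ln (real N / real m)))"
proof -
  have "real (N choose m) * fact m \<le> real N ^ m"
    using binomial_fact_pow[of N m] by (metis of_nat_fact of_nat_le_iff of_nat_mult of_nat_power)
  moreover have "real (N choose m) * exp (real m * (ln (real m) - 1)) \<le> real (N choose m) * fact m"
    using fact_ge_exp[OF assms(1)] by (intro mult_left_mono) auto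
  moreover have "real N ^ m = exp (real m * ln (real N))" using assms by (simp add: exp_of_nat_mult)
  ultimately have "real (N choose m) * exp (real m * (ln (real m) - 1)) \<le> exp (real m * ln (real N))"
    by linarith
  then have "real (N choose m) \<le> exp (real m * ln (real N)) / exp (real m * (ln (real m) - 1))"
    by (simp add: pos_le_divide_eq)
  also have "\<dots> = exp (real m * ln (real N) - real m * (ln (real m) - 1))" by (rule exp_diff[symmetric])
  also have "real m * ln (real N) - real m * (ln (real m) - 1) = real m * (1 + ln (real N / real m))"
    using assms by (simp add: ln_div algebra_simps)
  finally show ?thesis .
qed

text \<open>The bound \<open>(e\<^sup>2 * t / v) ^ v\<close>: weighting the \<open>j\<close>-th term
  by \<open>q ^ (v - j) \<ge> 1\<close> allows the sum to be extended to all
  \<open>j \<le> t\<close>, where the binomial theorem applies.\<close>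

lemma sum_choose_pow2_le_exp:
  assumes "0 < v" "v \<le> t"
  shows "real (\<Sum>j\<le>v. (t choose j) * 2 ^ j) \<le> exp (real v * (2 + ln (real t / real v)))"
proof -
  define q where "q = real t / real v"
  have q: "q \<ge> 1" using assms by (simp add: q_def)
  have "real (\<Sum>j\<le>v. (t choose j) * 2 ^ j) = (\<Sum>j\<le>v. real (t choose j) * 2 ^ j)" by simp
  also have "\<dots> \<le> (\<Sum>j\<le>v. q ^ v * (real (t choose j) * (2 / q) ^ j))"
  proof (rule sum_mono)
    fix j assume j: "j \<in> {..v}"
    have "q ^ v * (real (t choose j) * (2 / q) ^ j) = real (t choose j) * 2 ^ j * q ^ (v - j)"
      using q j by (simp add: power_divide power_diff field_simps)
    moreover have "real (t choose j) * 2 ^ j * 1 \<le> real (t choose j) * 2 ^ j * q ^ (v - j)"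
      using q by (intro mult_left_mono one_le_power) auto
    ultimately show "real (t choose j) * 2 ^ j \<le> q ^ v * (real (t choose j) * (2 / q) ^ j)" by linarith
  qed
  also have "\<dots> \<le> (\<Sum>j\<le>t. q ^ v * (real (t choose j) * (2 / q) ^ j))"
    using assms q by (intro sum_mono2) auto
  also have "\<dots> = q ^ v * (2 / q + 1) ^ t"
    by (simp add: binomial_ring sum_distrib_left)
  also have "\<dots> \<le> q ^ v * exp (2 / q) ^ t"
    using q exp_ge_add_one_self[of "2 / q"] by (intro mult_left_mono power_mono) (auto simp: add.commute)
  also have "\<dots> = exp (real v * ln q) * exp (real t * (2 / q))"
    unfolding exp_of_nat_mult using q by simp
  also have "real t * (2 / q) = 2 * real v" using assms by (simp add: q_def field_simps)
  also have "exp (real v * ln q) * exp (2 * real v) = exp (real v * (2 + ln q))"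
    by (simp add: exp_add[symmetric] algebra_simps)
  finally show ?thesis by (simp add: q_def)
qed

text \<open>\<open>n * ln n\<close> outgrows all other terms; \<open>q < 1\<close> makes the one
  with \<open>n powr q\<close> negligible.\<close>

lemma eventually_counting_gap:
  fixes e A B D c1 c2 q :: real
  assumes "e > 0" "q < 1"
  shows "eventually (\<lambda>n::nat. e * (real n * ln (real n)) - A * real n - D * (ln (real n) - B)
    - 2 * real n powr q * (c1 + c2 * ln (real n)) > 0) at_top"
  using assms by real_asymp

text \<open>Evenness of \<open>n * \<Delta>\<close> is the handshake condition, without which no
  \<open>\<Delta>\<close>-regular graph on \<open>n\<close> vertices exists.\<close>

theorem theorem1:
  fixes \<Delta> :: nat and \<epsilon> :: real
  assumes "\<Delta> \<ge> 5" and "\<epsilon> > 0"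
  shows "\<exists>N::nat. \<forall>n>N. even (n * \<Delta>) \<longrightarrow>
    (\<exists>G :: nat pair_pre_digraph. regular_graph \<Delta> G \<and> card (pverts G) = n \<and>
       real (slope_number G) > real n powr (1 - (8 + \<epsilon>) / (real \<Delta> + 4)))"
proof -
  \<comment> \<open>The cap 1/2 gives \<open>8 + e < \<Delta> + 4\<close>, hence
    \<open>q > 0\<close>, already for \<open>\<Delta> = 5\<close>; a smaller \<open>e\<close> only
    strengthens the bound.\<close>
  define e where "e = min \<epsilon> (1 / 2)"
  define d where "d = real \<Delta>"
  define q where "q = 1 - (8 + e) / (d + 4)"
  have e: "0 < e" "e \<le> \<epsilon>" "e \<le> 1 / 2" using assms(2) by (auto simp: e_def)
  have d: "d \<ge> 5" using assms(1) by (simp add: d_def)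
  have q: "0 < q" "q < 1" using e d by (auto simp: q_def field_simps)
  have q_eq: "(1 - q) * (d + 4) = 8 + e" using d by (simp add: q_def)
  \<comment> \<open>In \<open>c1\<close>, 2 comes from the binomial sum, \<open>3 / 2\<close> from
    the ratio \<open>t / v\<close> and 5 from the degree factor. \<open>B\<close> combines
    \<open>b \<ge> n / (4 * d)\<close> with the \<open>- 1\<close> of the Stirling bound, and
    \<open>A\<close> gathers the terms linear in \<open>n\<close>.\<close>
  define c1 where "c1 = 2 + ln (3 / 2) + ln (5::real)"
  define B where "B = ln (4 * d) + 1"
  define A where "A = d / 2 * B + 2 * c1 + d / 2 * (1 + ln 2)"
  have c1: "c1 > 0" unfolding c1_def by (intro add_pos_pos) auto
  have "eventually (\<lambda>n::nat. e / 2 * (real n * ln (real n)) - A * real n - 2 * d\<^sup>2 * (ln (real n) - B)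
      - 2 * real n powr q * (c1 + (1 + q) * ln (real n)) > 0) at_top"
    using e q by (intro eventually_counting_gap) auto
  moreover have "eventually (\<lambda>n::nat. ln (real n) \<ge> B) at_top" by real_asymp
  ultimately have "eventually (\<lambda>n::nat. e / 2 * (real n * ln (real n)) - A * real n
      - 2 * d\<^sup>2 * (ln (real n) - B) - 2 * real n powr q * (c1 + (1 + q) * ln (real n)) > 0
      \<and> ln (real n) \<ge> B) at_top"
    by eventually_elim simp
  then obtain N0 where N0: "\<And>n. n \<ge> N0 \<Longrightarrow> e / 2 * (real n * ln (real n)) - A * real n
      - 2 * d\<^sup>2 * (ln (real n) - B) - 2 * real n powr q * (c1 + (1 + q) * ln (real n)) > 0"
    "\<And>n. n \<ge> N0 \<Longrightarrow> ln (real n) \<ge> B"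
    unfolding eventually_at_top_linorder by auto
  show ?thesis
  proof (intro exI[of _ "max N0 (8 * \<Delta>)"] allI impI)
    fix n :: nat assume n: "n > max N0 (8 * \<Delta>)" and even: "even (n * \<Delta>)"
    define L where "L = ln (real n)"
    \<comment> \<open>One less than the quotient, so that at least \<open>2 * \<Delta>\<close>
      vertices remain for the circulant graph.\<close>
    define b where "b = n div (2 * \<Delta>) - 1"
    have n8: "real n \<ge> 8 * d" using n by (simp add: d_def)
    have n40: "real n \<ge> 40" using n8 d by simp
    have L0: "L \<ge> 0" using n40 by (simp add: L_def)
    have "4 \<le> n div (2 * \<Delta>)"
    proof -
      have "4 * (2 * \<Delta>) div (2 * \<Delta>) \<le> n div (2 * \<Delta>)" using n by (intro div_le_mono) simp
      then show ?thesis using assms(1) by simp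
    qed
    then have b_suc: "b + 1 = n div (2 * \<Delta>)" by (simp add: b_def)
    have b_le: "2 * \<Delta> * (b + 1) \<le> n" unfolding b_suc by simp
    have "n < 2 * \<Delta> * (b + 2)"
      using dividend_less_div_times[of "2 * \<Delta>" n] assms(1) b_suc by (simp add: algebra_simps)
    then have "real n < real (2 * \<Delta> * (b + 2))" by (simp only: of_nat_less_iff)
    then have b_ge: "d * real b \<ge> real n / 2 - 2 * d" by (simp add: d_def algebra_simps)
    have b4: "real b \<ge> real n / (4 * d)"
    proof -
      have "d * real b \<ge> real n / 4" using b_ge n8 by linarith
      then show ?thesis using d by (simp add: field_simps)
    qed
    have "real n / (4 * d) > 0" using n40 d by simp
    then have b0: "0 < b" using b4 by linarith
    have "\<Delta> > 0" using assms(1) by simp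
    obtain \<GG> :: "nat pair_pre_digraph set" where \<GG>: "finite \<GG>" "card \<GG> = fact b ^ (\<Delta> * \<Delta>)"
      "\<And>G. G \<in> \<GG> \<Longrightarrow> regular_graph \<Delta> G" "\<And>G. G \<in> \<GG> \<Longrightarrow> pverts G = {..<n}"
      using many_regular_graphs[OF \<open>\<Delta> > 0\<close> b_le even] by blast
    have "\<exists>G\<in>\<GG>. real (slope_number G) > real n powr q"
    proof (rule ccontr)
      assume neg: "\<not> (\<exists>G\<in>\<GG>. real (slope_number G) > real n powr q)"
      define k where "k = nat \<lfloor>real n powr q\<rfloor>"
      define m where "m = n * \<Delta> div 2"
      define t where "t = 3 * n * n * k"
      define v where "v = 2 * n + 2 * k"
      have powr1: "real n powr q \<ge> 1" using n40 q by (intro ge_one_powr_ge_zero) auto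
      have k_le: "real k \<le> real n powr q" using powr1 unfolding k_def by simp
      have k1: "k \<ge> 1" using powr1 unfolding k_def by (simp add: le_nat_floor)
      have m2: "2 * m = n * \<Delta>" using even by (simp add: m_def)
      then have "real (2 * m) = real (n * \<Delta>)" by (simp only:)
      then have m_real: "real m = real n * d / 2" by (simp add: d_def)
      have m0: "0 < m" using m2 n assms(1) by (cases m) auto
      have v0: "0 < v" using k1 by (simp add: v_def)
      have "2 * n + 2 * k \<le> 2 * (n * k) + 2 * (n * k)" using k1 n by (intro add_mono) auto
      also have "\<dots> \<le> 3 * n * n * k" using n assms(1) by simp
      finally have vt: "v \<le> t" by (simp add: v_def t_def)
      have "card \<GG> \<le> (\<Sum>j\<le>2 * n + 2 * k. (3 * n * n * k choose j) * 2 ^ j) * 5 ^ (2 * n + 2 * k) * (n * k choose m)"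
      proof (rule card_graphs_few_slopes_le[OF \<GG>(1)])
        fix G assume G: "G \<in> \<GG>"
        show "pair_graph G \<and> pverts G = {..<n} \<and> card (parcs G) = 2 * m"
          using \<GG>(3,4)[OF G] card_parcs_regular[OF \<GG>(3)[OF G]] m2 by (simp add: regular_graph_def)
        show "slope_number G \<le> k" using neg G unfolding k_def by (simp add: le_nat_floor not_less)
      qed
      then have "fact b ^ (\<Delta> * \<Delta>) \<le> (\<Sum>j\<le>v. (t choose j) * 2 ^ j) * 5 ^ v * (n * k choose m)"
        by (simp only: \<GG>(2) t_def v_def)
      then have "real (fact b ^ (\<Delta> * \<Delta>)) \<le> real ((\<Sum>j\<le>v. (t choose j) * 2 ^ j) * 5 ^ v * (n * k choose m))"
        by (simp only: of_nat_le_iff)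
      also have "\<dots> = real (\<Sum>j\<le>v. (t choose j) * 2 ^ j) * 5 ^ v * real (n * k choose m)"
        by (simp only: of_nat_mult of_nat_power of_nat_numeral)
      also have "\<dots> \<le> exp (real v * (2 + ln (real t / real v))) * exp (real v * ln 5) *
          exp (real m * (1 + ln (real (n * k) / real m)))"
      proof (intro mult_mono sum_choose_pow2_le_exp choose_le_exp v0 vt m0)
        show "(5::real) ^ v \<le> exp (real v * ln 5)" by (simp add: exp_of_nat_mult)
        show "0 < n * k" using n k1 by simp
      qed auto
      also have "\<dots> = exp (real v * (2 + ln (real t / real v) + ln 5) + real m * (1 + ln (real (n * k) / real m)))"
        by (simp add: exp_add[symmetric] algebra_simps)
      finally have upper: "real (fact b ^ (\<Delta> * \<Delta>)) \<le>
          exp (real v * (2 + ln (real t / real v) + ln 5) + real m * (1 + ln (real (n * k) / real m)))" .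
      have "exp (real (\<Delta> * \<Delta>) * (real b * (ln (real b) - 1))) = exp (real b * (ln (real b) - 1)) ^ (\<Delta> * \<Delta>)"
        by (rule exp_of_nat_mult)
      also have "\<dots> \<le> fact b ^ (\<Delta> * \<Delta>)" using fact_ge_exp[OF b0] by (intro power_mono) auto
      also have "fact b ^ (\<Delta> * \<Delta>) = real (fact b ^ (\<Delta> * \<Delta>))" by simp
      also note upper
      finally have "exp (real (\<Delta> * \<Delta>) * (real b * (ln (real b) - 1))) \<le>
          exp (real v * (2 + ln (real t / real v) + ln 5) + real m * (1 + ln (real (n * k) / real m)))" .
      then have compare: "d * d * (real b * (ln (real b) - 1)) \<le>
          real v * (2 + ln (real t / real v) + ln 5) + real m * (1 + ln (real (n * k) / real m))"
        by (simp add: d_def)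
      have lower: "(d * real n / 2 - 2 * d\<^sup>2) * (L - B) \<le> d * d * (real b * (ln (real b) - 1))"
      proof -
        have "ln (real n / (4 * d)) \<le> ln (real b)" using b4 \<open>real n / (4 * d) > 0\<close> by (simp add: b0)
        moreover have "ln (real n / (4 * d)) = L - ln (4 * d)" using n40 d by (simp add: ln_div L_def)
        ultimately have lnb: "L - B \<le> ln (real b) - 1" by (simp add: B_def)
        have LB: "0 \<le> L - B" using N0(2)[of n] n by (simp add: L_def)
        have "d * real n / 2 - 2 * d\<^sup>2 = d * (real n / 2 - 2 * d)" by (simp add: power2_eq_square algebra_simps)
        also have "\<dots> \<le> d * (d * real b)" using b_ge d by (intro mult_left_mono) auto
        finally have "(d * real n / 2 - 2 * d\<^sup>2) * (L - B) \<le> d * (d * real b) * (L - B)"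
          using LB by (rule mult_right_mono)
        also have "\<dots> \<le> d * (d * real b) * (ln (real b) - 1)" using lnb d by (intro mult_left_mono) auto
        finally show ?thesis by (simp add: mult.assoc)
      qed
      have ln_powr: "ln (real n powr q) = q * L" using n40 by (simp add: L_def ln_powr)
      have upper1: "real v * (2 + ln (real t / real v) + ln 5) \<le> (2 * real n + 2 * real n powr q) * (c1 + (1 + q) * L)"
      proof -
        \<comment> \<open>The \<open>2 * n\<close> in \<open>v\<close> cancels one factor
          \<open>n\<close> of \<open>t\<close>; this is why a coordinate costs
          \<open>(1 + q) * L\<close> and not \<open>(2 + q) * L\<close>.\<close>
        have "real t / real v \<le> real t / (2 * real n)"
          using n40 v0 by (intro divide_left_mono mult_pos_pos) (auto simp: v_def)
        also have "\<dots> = 3 / 2 * (real n * real k)" using n40 by (simp add: t_def)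
        also have "\<dots> \<le> 3 / 2 * (real n * real n powr q)" using k_le n40 by (intro mult_left_mono) auto
        finally have le: "real t / real v \<le> 3 / 2 * (real n * real n powr q)" .
        have "real t / real v > 0" using v0 vt by simp
        then have "ln (real t / real v) \<le> ln (3 / 2 * (real n * real n powr q))"
          using le by (intro ln_mono)
        also have "\<dots> = ln (3 / 2) + (L + q * L)"
          using n40 powr1 by (subst ln_mult_pos) (auto simp: ln_mult_pos ln_powr L_def)
        finally have "2 + ln (real t / real v) + ln 5 \<le> c1 + (1 + q) * L"
          by (simp add: c1_def algebra_simps)
        moreover have "0 \<le> c1 + (1 + q) * L" using c1 L0 q by simp
        moreover have "real v \<le> 2 * real n + 2 * real n powr q" using k_le by (simp add: v_def)
        ultimately show ?thesis
          by (meson mult_left_mono mult_right_mono of_nat_0_le_iff order_trans)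
      qed
      have upper2: "real m * (1 + ln (real (n * k) / real m)) \<le> real n * d / 2 * (1 + (ln 2 + q * L))"
      proof -
        have "real (n * k) / real m = 2 * real k / d" using n40 d by (simp add: m_real)
        also have "\<dots> \<le> 2 * real k" using d by (simp add: divide_le_eq mult_le_cancel_left1)
        also have "\<dots> \<le> 2 * real n powr q" using k_le by simp
        finally have le: "real (n * k) / real m \<le> 2 * real n powr q" .
        have "real (n * k) / real m > 0" using m0 n k1 by simp
        then have "ln (real (n * k) / real m) \<le> ln (2 * real n powr q)"
          using le by (intro ln_mono)
        also have "\<dots> = ln 2 + q * L" by (subst ln_mult_pos) (use powr1 ln_powr in linarith)+
        finally show ?thesis unfolding m_real using d by (intro mult_left_mono) auto
      qed
      \<comment> \<open>The coefficient of \<open>n * L\<close> is \<open>d / 2\<close> from the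
        lifts, minus \<open>2 * (1 + q)\<close> from the patterns, minus \<open>q * d / 2\<close>
        from the choice of edges; the definition of \<open>q\<close> makes it
        \<open>e / 2\<close>.\<close>
      have "(d * real n / 2 - 2 * d\<^sup>2) * (L - B) - (2 * real n + 2 * real n powr q) * (c1 + (1 + q) * L)
          - real n * d / 2 * (1 + (ln 2 + q * L))
        = ((1 - q) * (d + 4) / 2 - 4) * (real n * L) - A * real n - 2 * d\<^sup>2 * (L - B)
          - 2 * real n powr q * (c1 + (1 + q) * L)"
        by (simp add: A_def field_simps)
      also have "(1 - q) * (d + 4) / 2 - 4 = e / 2" using q_eq by linarith
      finally show False using N0(1)[of n] n compare lower upper1 upper2 unfolding L_def[symmetric] by auto
    qed
    then obtain G where G: "G \<in> \<GG>" "real (slope_number G) > real n powr q" by blast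
    have "1 - (8 + \<epsilon>) / (real \<Delta> + 4) \<le> q"
      using e(2) d by (simp add: q_def d_def divide_right_mono)
    then have "real n powr (1 - (8 + \<epsilon>) / (real \<Delta> + 4)) \<le> real n powr q"
      using n40 by (intro powr_mono) auto
    then show "\<exists>G :: nat pair_pre_digraph. regular_graph \<Delta> G \<and> card (pverts G) = n \<and>
       real (slope_number G) > real n powr (1 - (8 + \<epsilon>) / (real \<Delta> + 4))"
      using G \<GG>(3,4)[OF G(1)] by (intro exI[of _ G]) auto
  qed
qed

end
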